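(* Let $A_1\in\mathbb{C}_{\rm H}^{m_1}$, $B_1\in\mathbb{C}^{m_1\times n}$ and $A_4,B_4\in\mathbb{C}^{m\times n}$ be given. Assume that the matrix equation $B_4X=A_4$ has a Hermitian solution, i.e., $\mathscr{R}(A_4)\subseteq\mathscr{R}(B_4)$ and $A_4B_4^{*}=B_4A_4^{*}$, and let $$\mathcal{S}=\{X\in\mathbb{C}_{\rm H}^{n}\mid B_4X=A_4\},\quad M=\begin{bmatrix} A_1 & B_1 \\ A_4B_1^{*} & B_4 \end{bmatrix},\quad N=\begin{bmatrix} A_1 & B_1 & 0 \\ B_1^{*} & 0 & B_4^{*} \\ 0 & B_4 & -A_4B_4^{*} \end{bmatrix}.$$ Then $$\max_{X\in\mathcal{S}}r(A_1-B_1XB_1^{*})=r(M)-r(B_4),\qquad \min_{X\in\mathcal{S}}r(A_1-B_1XB_1^{*})=2r(M)-r(N),$$ $$\max_{X\in\mathcal{S}}i_{\pm}(A_1-B_1XB_1^{*})=i_{\pm}(N)-r(B_4),\qquad \min_{X\in\mathcal{S}}i_{\pm}(A_1-B_1XB_1^{*})=r(M)-i_{\mp}(N).$$ In consequence: (a) $B_4X=A_4$ has a solution $X\in\mathbb{C}_{\rm H}^{n}$ such that $A_1-B_1XB_1^{*}$ is nonsingular if and only if $r(M)=r(B_4)+m_1$. (b) $A_1-B_1XB_1^{*}$ is nonsingular for all Hermitian solutions $X$ of $B_4X=A_4$ if and only if $2r(M)=r(N)+m_1$. (c) The pair of equations $B_1XB_1^{*}=A_1$ and $B_4X=A_4$ have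 a common Hermitian solution if and only if $\mathscr{R}\begin{bmatrix} A_1 \\ A_4B_1^{*} \end{bmatrix}\subseteq\mathscr{R}\begin{bmatrix} B_1 \\ B_4 \end{bmatrix}$. (d) $B_1XB_1^{*}=A_1$ holds for all Hermitian solutions of $B_4X=A_4$ if and only if $r(M)=r(B_4)$. (e) $B_4X=A_4$ has a solution $X\in\mathbb{C}_{\rm H}^{n}$ such that $A_1-B_1XB_1^{*}>0$ (respectively $<0$) if and only if $i_{+}(N)=r(B_4)+m_1$ (respectively $i_{-}(N)=r(B_4)+m_1$). (f) $A_1-B_1XB_1^{*}>0$ (respectively $<0$) holds for all Hermitian solutions of $B_4X=A_4$ if and only if $r(M)=i_{-}(N)+m_1$ (respectively $r(M)=i_{+}(N)+m_1$). (g) $B_4X=A_4$ has a solution $X\in\mathbb{C}_{\rm H}^{n}$ such that $A_1-B_1XB_1^{*}\geqslant0$ (respectively $\leqslant0$) if and only if $r(M)=i_{+}(N)$ (respectively $r(M)=i_{-}(N)$). (h) $A_1-B_1XB_1^{*}\geqslant0$ (respectively $\leqslant0$) holds for all Hermitian solutions of $B_4X=A_4$ if and only if $i_{-}(N)=r(B_4)$ (respectively $i_{+}(N)=r(B_4)$).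
   Context: $\mathbb{C}_{\rm H}^{m}$ is the set of $m\times m$ complex Hermitian matrices, $A^{*}$ the conjugate transpose, $r(A)$ the rank, $\mathscr{R}(A)$ the range (column space). For Hermitian $A$, $i_{+}(A)$ and $i_{-}(A)$ are the numbers of positive and negative eigenvalues counted with multiplicity; $A>0$ ($A\geqslant0$, $A<0$, $A\leqslant 0$) means $A$ is positive definite (positive semi-definite, negative definite, negative semi-definite). A formula with $\pm$ and $\mp$ stands for two formulas: all upper signs, or all lower signs. *)

theory Defs
  imports
    "Jordan_Normal_Form.Schur_Decomposition"
    "Jordan_Normal_Form.DL_Rank"
    "Jordan_Normal_Form.Char_Poly"
    "HOL-Library.Complex_Order"
begin

abbreviation mrank :: "complex mat \<Rightarrow> nat" where
  "mrank A \<equiv> vec_space.rank (dim_row A) A"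

abbreviation mrange :: "complex mat \<Rightarrow> complex vec set" where
  "mrange A \<equiv> vec_space.col_space (dim_row A) A"

definition herm_mats :: "nat \<Rightarrow> complex mat set" where
  "herm_mats n = {A \<in> carrier_mat n n. mat_adjoint A = A}"

(* In HOL-Library.Complex_Order, 0 < z (and likewise z < 0, 0 \<le> z, z \<le> 0) for complex z says
   that z is real and has the indicated sign.  The multiset proots (char_poly A) lists the
   eigenvalues with algebraic multiplicity, which for Hermitian A is also the geometric one. *)

definition pos_inertia :: "complex mat \<Rightarrow> nat" where
  "pos_inertia A = size {# z \<in># proots (char_poly A). 0 < z #}"

definition neg_inertia :: "complex mat \<Rightarrow> nat" where
  "neg_inertia A = size {# z \<in># proots (char_poly A). z < 0 #}"

(* (A *\<^sub>v v) \<bullet>c v is the Hermitian form v^* A v. *)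

definition pos_def :: "complex mat \<Rightarrow> bool" where
  "pos_def A \<longleftrightarrow> A \<in> herm_mats (dim_row A) \<and>
     (\<forall>v \<in> carrier_vec (dim_row A). v \<noteq> 0\<^sub>v (dim_row A) \<longrightarrow> 0 < (A *\<^sub>v v) \<bullet>c v)"

definition pos_semidef :: "complex mat \<Rightarrow> bool" where
  "pos_semidef A \<longleftrightarrow> A \<in> herm_mats (dim_row A) \<and>
     (\<forall>v \<in> carrier_vec (dim_row A). 0 \<le> (A *\<^sub>v v) \<bullet>c v)"

definition neg_def :: "complex mat \<Rightarrow> bool" where
  "neg_def A \<longleftrightarrow> A \<in> herm_mats (dim_row A) \<and>
     (\<forall>v \<in> carrier_vec (dim_row A). v \<noteq> 0\<^sub>v (dim_row A) \<longrightarrow> (A *\<^sub>v v) \<bullet>c v < 0)"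

definition neg_semidef :: "complex mat \<Rightarrow> bool" where
  "neg_semidef A \<longleftrightarrow> A \<in> herm_mats (dim_row A) \<and>
     (\<forall>v \<in> carrier_vec (dim_row A). (A *\<^sub>v v) \<bullet>c v \<le> 0)"

(* Attained maximum and minimum; Max and Min of the image would be unspecified for empty or
   infinite images.  The value v is an integer so that differences do not truncate. *)

definition has_max_on :: "('a \<Rightarrow> nat) \<Rightarrow> 'a set \<Rightarrow> int \<Rightarrow> bool" where
  "has_max_on f S v \<longleftrightarrow> (\<exists>x\<in>S. int (f x) = v) \<and> (\<forall>x\<in>S. int (f x) \<le> v)"

definition has_min_on :: "('a \<Rightarrow> nat) \<Rightarrow> 'a set \<Rightarrow> int \<Rightarrow> bool" where
  "has_min_on f S v \<longleftrightarrow> (\<exists>x\<in>S. int (f x) = v) \<and> (\<forall>x\<in>S. v \<le> int (f x))"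

definition herm_sols :: "nat \<Rightarrow> complex mat \<Rightarrow> complex mat \<Rightarrow> complex mat set" where
  "herm_sols n B A = {X \<in> herm_mats n. B * X = A}"

definition block_M :: "complex mat \<Rightarrow> complex mat \<Rightarrow> complex mat \<Rightarrow> complex mat \<Rightarrow> complex mat" where
  "block_M A1 B1 A4 B4 = four_block_mat A1 B1 (A4 * mat_adjoint B1) B4"

(* The 3 x 3 block matrix [A1, B1, 0; B1^*, 0, B4^*; 0, B4, -A4 B4^*], its upper left 2 x 2
   blocks being grouped together.  The third argument of the outer four_block_mat is the block
   row [0, B4], written as a four_block_mat with empty lower part. *)
definition block_N :: "complex mat \<Rightarrow> complex mat \<Rightarrow> complex mat \<Rightarrow> complex mat \<Rightarrow> complex mat" where
  "block_N A1 B1 A4 B4 = (let m1 = dim_row A1; n = dim_col B1; m = dim_row B4 in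
     four_block_mat
       (four_block_mat A1 B1 (mat_adjoint B1) (0\<^sub>m n n))
       (0\<^sub>m m1 m @\<^sub>r mat_adjoint B4)
       (four_block_mat (0\<^sub>m m m1) B4 (0\<^sub>m 0 m1) (0\<^sub>m 0 n))
       (- (A4 * mat_adjoint B4)))"

end

theory Submission
  imports Defs
begin

text \<open>Everything reduces to one normal form. Fix a Hermitian solution \<open>X\<^sub>0\<close> and a matrix \<open>F\<close> whose
  columns are a basis of the kernel of \<open>B\<^sub>4\<close>; the Hermitian solutions are \<open>X\<^sub>0 + F W F\<^sup>*\<close> with \<open>W\<close> Hermitian,
  so the matrices in question are \<open>C - J W J\<^sup>*\<close> with \<open>C = A\<^sub>1 - B\<^sub>1 X\<^sub>0 B\<^sub>1\<^sup>*\<close> and \<open>J = B\<^sub>1 F\<close>. In a basis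
  adapted to the range of \<open>J\<close>, the matrix \<open>C - J W J\<^sup>*\<close> has an arbitrary Hermitian upper left block of size
  \<open>k = r(J)\<close>, and eliminating with the lower right block (inertia \<open>(p, q)\<close>) makes it congruent
  to \<open>D \<oplus> [H, E; E\<^sup>*, 0]\<close> with \<open>D\<close> of inertia \<open>(p, q)\<close> and \<open>H\<close> arbitrary. With \<open>e = r(E)\<close> its inertia
  is \<open>(p + e + a, q + e + b)\<close>, where \<open>(a, b)\<close> is the inertia of a compression of \<open>H\<close> to dimension \<open>k - e\<close>.
  The same elimination gives \<open>r(M) = r(B\<^sub>4) + p + q + e + k\<close> and \<open>i\<^sub>\<plusminus>(N) = r(B\<^sub>4) + k + (p, q)\<close>, and
  all claims become arithmetic in \<open>p, q, e, k, r(B\<^sub>4)\<close>.\<close>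

section \<open>Adjoints and dimension-checked matrix algebra\<close>

notation mat_adjoint ("(_\<^sup>H)" [1000] 999)

lemma dim_adj [simp]: "dim_row (A\<^sup>H) = dim_col A" "dim_col (A\<^sup>H) = dim_row A"
  by (simp_all add: mat_adjoint_def)

lemma index_adj [simp]:
  "i < dim_col A \<Longrightarrow> j < dim_row A \<Longrightarrow> A\<^sup>H $$ (i, j) = cnj (A $$ (j, i))"
  by (simp add: mat_adjoint_def mat_of_rows_def)

lemma carrier_adj [simp]: "A \<in> carrier_mat n m \<Longrightarrow> A\<^sup>H \<in> carrier_mat m n"
  by (metis carrier_matD carrier_matI dim_adj)

lemma adj_adj [simp]: "(A\<^sup>H)\<^sup>H = (A :: complex mat)"
  by (rule eq_matI) auto

lemma adj_mult [simp]:
  "dim_col A = dim_row B \<Longrightarrow> (A * B :: complex mat)\<^sup>H = B\<^sup>H * A\<^sup>H"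
  by (rule eq_matI) (auto simp: scalar_prod_def mult.commute)

lemma adj_add [simp]:
  "dim_row A = dim_row B \<Longrightarrow> dim_col A = dim_col B \<Longrightarrow> (A + B :: complex mat)\<^sup>H = A\<^sup>H + B\<^sup>H"
  by (rule eq_matI) auto

lemma adj_diff [simp]:
  "dim_row A = dim_row B \<Longrightarrow> dim_col A = dim_col B \<Longrightarrow> (A - B :: complex mat)\<^sup>H = A\<^sup>H - B\<^sup>H"
  by (rule eq_matI) auto

lemma adj_uminus [simp]: "(- A :: complex mat)\<^sup>H = - A\<^sup>H"
  by (rule eq_matI) auto

lemma adj_smult [simp]: "(c \<cdot>\<^sub>m A :: complex mat)\<^sup>H = cnj c \<cdot>\<^sub>m A\<^sup>H"
  by (rule eq_matI) auto

lemma adj_zero [simp]: "(0\<^sub>m n m :: complex mat)\<^sup>H = 0\<^sub>m m n"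
  by (rule eq_matI) auto

lemma adj_one [simp]: "(1\<^sub>m n :: complex mat)\<^sup>H = 1\<^sub>m n"
  by (rule eq_matI) auto

lemma adj_four_block [simp]:
  fixes A B C D :: "complex mat"
  assumes "dim_row A = dim_row B" "dim_row C = dim_row D" "dim_col A = dim_col C" "dim_col B = dim_col D"
  shows "(four_block_mat A B C D)\<^sup>H = four_block_mat (A\<^sup>H) (C\<^sup>H) (B\<^sup>H) (D\<^sup>H)"
  using assms by (intro eq_matI) auto

text \<open>The library states matrix algebra over carriers whose dimensions the simplifier cannot guess;
  the following variants have only equations between dimensions as conditions.\<close>

named_theorems mat_ring

lemma mult_assoc_mat [mat_ring]:
  "dim_col A = dim_row B \<Longrightarrow> dim_col B = dim_row C \<Longrightarrow> (A * B) * C = A * (B * C :: complex mat)"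
  by (rule assoc_mult_mat[of A "dim_row A" "dim_col A" B "dim_col B" C "dim_col C"]) auto

lemma mult_add_mat [mat_ring]:
  "dim_col A = dim_row B \<Longrightarrow> dim_row C = dim_row B \<Longrightarrow> dim_col C = dim_col B \<Longrightarrow>
   A * (B + C) = A * B + A * (C :: complex mat)"
  by (rule mult_add_distrib_mat[of A "dim_row A" "dim_row B" B "dim_col B" C]) auto

lemma add_mult_mat [mat_ring]:
  "dim_row A = dim_row B \<Longrightarrow> dim_col A = dim_col B \<Longrightarrow> dim_col B = dim_row C \<Longrightarrow>
   (A + B) * C = A * C + B * (C :: complex mat)"
  by (rule add_mult_distrib_mat[of A "dim_row A" "dim_col A" B C "dim_col C"]) auto

lemma mult_diff_mat [mat_ring]:
  "dim_col A = dim_row B \<Longrightarrow> dim_row C = dim_row B \<Longrightarrow> dim_col C = dim_col B \<Longrightarrow>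
   A * (B - C) = A * B - A * (C :: complex mat)"
  by (rule mult_minus_distrib_mat[of A "dim_row A" "dim_row B" B "dim_col B" C]) auto

lemma diff_mult_mat [mat_ring]:
  "dim_row A = dim_row B \<Longrightarrow> dim_col A = dim_col B \<Longrightarrow> dim_col B = dim_row C \<Longrightarrow>
   (A - B) * C = A * C - B * (C :: complex mat)"
  by (rule minus_mult_distrib_mat[of A "dim_row A" "dim_col A" B C "dim_col C"]) auto

lemma smult_mult_mat [mat_ring]:
  "dim_col A = dim_row B \<Longrightarrow> (k \<cdot>\<^sub>m A) * B = k \<cdot>\<^sub>m (A * B :: complex mat)"
  by (rule mult_smult_assoc_mat[of A "dim_row A" "dim_col A" B "dim_col B"]) auto

lemma mult_smult_mat [mat_ring]:
  "dim_col A = dim_row B \<Longrightarrow> A * (k \<cdot>\<^sub>m B) = k \<cdot>\<^sub>m (A * B :: complex mat)"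
  by (rule mult_smult_distrib[of A "dim_row A" "dim_col A" B "dim_col B"]) auto

lemma uminus_mult_mat [mat_ring]:
  "dim_col A = dim_row B \<Longrightarrow> (- A) * B = - (A * B :: complex mat)"
  by (simp add: uminus_mult_left_mat)

lemma mult_uminus_mat [mat_ring]:
  "dim_col A = dim_row B \<Longrightarrow> A * (- B) = - (A * B :: complex mat)"
  by (simp add: uminus_mult_right_mat)

lemma one_mult_mat [mat_ring]: "dim_row A = n \<Longrightarrow> 1\<^sub>m n * A = (A :: complex mat)"
  by (rule left_mult_one_mat[of A n "dim_col A"]) auto

lemma mult_one_mat [mat_ring]: "dim_col A = n \<Longrightarrow> A * 1\<^sub>m n = (A :: complex mat)"
  by (rule right_mult_one_mat[of A "dim_row A" n]) auto

lemma zero_mult_mat [mat_ring]: "dim_row A = n \<Longrightarrow> 0\<^sub>m m n * A = (0\<^sub>m m (dim_col A) :: complex mat)"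
  by (rule left_mult_zero_mat[of A n "dim_col A"]) auto

lemma mult_zero_mat [mat_ring]: "dim_col A = n \<Longrightarrow> A * 0\<^sub>m n m = (0\<^sub>m (dim_row A) m :: complex mat)"
  by (rule right_mult_zero_mat[of A "dim_row A" n]) auto

lemma add_zero_mat [mat_ring]:
  "dim_row A = n \<Longrightarrow> dim_col A = m \<Longrightarrow> A + 0\<^sub>m n m = (A :: complex mat)"
  "dim_row A = n \<Longrightarrow> dim_col A = m \<Longrightarrow> 0\<^sub>m n m + A = (A :: complex mat)"
  "dim_row A = n \<Longrightarrow> dim_col A = m \<Longrightarrow> A - 0\<^sub>m n m = (A :: complex mat)"
  by (auto intro!: eq_matI)

lemma uminus_zero_mat [mat_ring]: "- (0\<^sub>m n m :: complex mat) = 0\<^sub>m n m"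
  by (auto intro!: eq_matI)

lemma mult_four_block [mat_ring]:
  fixes A1 :: "complex mat"
  assumes "dim_row A1 = dim_row B1" "dim_row C1 = dim_row D1"
    "dim_col A1 = dim_col C1" "dim_col B1 = dim_col D1"
    "dim_row A2 = dim_row B2" "dim_row C2 = dim_row D2"
    "dim_col A2 = dim_col C2" "dim_col B2 = dim_col D2"
    "dim_col A1 = dim_row A2" "dim_col B1 = dim_row C2"
  shows "four_block_mat A1 B1 C1 D1 * four_block_mat A2 B2 C2 D2
    = four_block_mat (A1 * A2 + B1 * C2) (A1 * B2 + B1 * D2)
        (C1 * A2 + D1 * C2) (C1 * B2 + D1 * D2)"
  by (rule mult_four_block_mat[of A1 "dim_row A1" "dim_col A1" B1 "dim_col B1" C1 "dim_row C1" D1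
        A2 "dim_col A2" B2 "dim_col B2" C2 D2]) (use assms in auto)

text \<open>Block rows and block columns are encoded as \<open>four_block_mat\<close> with empty
  blocks. Padding the other factor with empty blocks too brings the product under the 2 x 2
  rule.\<close>

lemma mult_row_block:
  fixes A B C :: "complex mat"
  assumes "dim_col A = dim_row B" "dim_row C = dim_row B" "dim_col B = b" "dim_col C = c"
  shows "A * four_block_mat B C (0\<^sub>m 0 b) (0\<^sub>m 0 c) = four_block_mat (A * B) (A * C) (0\<^sub>m 0 b) (0\<^sub>m 0 c)"
proof -
  have "A * four_block_mat B C (0\<^sub>m 0 b) (0\<^sub>m 0 c) = four_block_mat A (0\<^sub>m (dim_row A) 0) (0\<^sub>m 0 (dim_col A)) (0\<^sub>m 0 0) * four_block_mat B C (0\<^sub>m 0 b) (0\<^sub>m 0 c)"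
    by (rule arg_cong2[of _ _ _ _ "(*)"]) (auto intro!: eq_matI)
  then show ?thesis using assms by (simp add: mat_ring)
qed

lemma mult_col_block:
  fixes A B C :: "complex mat"
  assumes "dim_col A = dim_row C" "dim_col B = dim_row C" "dim_row A = a" "dim_row B = b"
  shows "four_block_mat A (0\<^sub>m a 0) B (0\<^sub>m b 0) * C = four_block_mat (A * C) (0\<^sub>m a 0) (B * C) (0\<^sub>m b 0)"
proof -
  have "four_block_mat A (0\<^sub>m a 0) B (0\<^sub>m b 0) * C = four_block_mat A (0\<^sub>m a 0) B (0\<^sub>m b 0) * four_block_mat C (0\<^sub>m (dim_row C) 0) (0\<^sub>m 0 (dim_col C)) (0\<^sub>m 0 0)"
    by (rule arg_cong2[of _ _ _ _ "(*)"]) (auto intro!: eq_matI)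
  then show ?thesis using assms by (simp add: mat_ring)
qed

text \<open>\<open>mat_ring\<close> nests products to the right, which hides \<open>X * Y\<close>
  inside \<open>X * (Y * W)\<close>; in this form a product equation still rewrites there.\<close>

lemma mult_assoc_eq:
  "X * Y = Z \<Longrightarrow> dim_col X = dim_row Y \<Longrightarrow> dim_col Y = dim_row W \<Longrightarrow> X * (Y * W) = Z * (W :: complex mat)"
  by (simp add: mult_assoc_mat[symmetric])

lemma mult_mat_vec_assoc:
  "dim_col A = dim_row B \<Longrightarrow> dim_vec v = dim_col B \<Longrightarrow> A * B *\<^sub>v v = A *\<^sub>v (B *\<^sub>v (v :: complex vec))"
  by (rule assoc_mult_mat_vec[of A "dim_row A" "dim_col A" B "dim_col B"]) (auto intro: carrier_vecI)

text \<open>Mostly used with \<open>index_mult_mat(1)\<close> removed from the simpset: entries of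
  products then stay atoms, and an additive matrix identity becomes an identity between complex
  numbers.\<close>

lemma mat_eq_entrywiseI:
  fixes A B :: "complex mat"
  assumes "dim_row A = dim_row B" "dim_col A = dim_col B"
    "\<And>i j. i < dim_row A \<Longrightarrow> j < dim_col A \<Longrightarrow> A $$ (i, j) = B $$ (i, j)"
  shows "A = B"
  using assms by (intro eq_matI) auto

section \<open>Rank and inertia through factorizations\<close>

text \<open>A full rank factorization: \<open>L\<close> and \<open>R\<close> witness that
  \<open>X\<close> has full column rank and \<open>Y\<close> full row rank. Such witnesses can be
  transported by matrix algebra alone.\<close>

definition has_rank :: "complex mat \<Rightarrow> nat \<Rightarrow> bool" where
  "has_rank A r \<longleftrightarrow> (\<exists>X Y L R. dim_row X = dim_row A \<and> dim_col X = r \<and> dim_row Y = r \<and>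
     dim_col Y = dim_col A \<and> dim_row L = r \<and> dim_col L = dim_row A \<and> dim_row R = dim_col A \<and>
     dim_col R = r \<and> X * Y = A \<and> L * X = 1\<^sub>m r \<and> Y * R = 1\<^sub>m r)"

text \<open>The matrices K and L witness that the columns of P and Q together are linearly independent.\<close>

definition has_inertia :: "complex mat \<Rightarrow> nat \<Rightarrow> nat \<Rightarrow> bool" where
  "has_inertia A p q \<longleftrightarrow> (\<exists>P Q K L. dim_row P = dim_row A \<and> dim_col P = p \<and>
     dim_row Q = dim_row A \<and> dim_col Q = q \<and> dim_row K = p \<and> dim_col K = dim_row A \<and>
     dim_row L = q \<and> dim_col L = dim_row A \<and> P * P\<^sup>H - Q * Q\<^sup>H = A \<and>
     K * P = 1\<^sub>m p \<and> K * Q = 0\<^sub>m p q \<and> L * P = 0\<^sub>m q p \<and> L * Q = 1\<^sub>m q)"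

lemma mrange_mult_subset:
  assumes "dim_col A = dim_row B"
  shows "mrange (A * B) \<subseteq> mrange A"
proof
  have "A * B \<in> carrier_mat (dim_row A) (dim_col B)" and A: "A \<in> carrier_mat (dim_row A) (dim_col A)" by auto
  note AB = vec_space.col_space_eq[OF this(1)] and A = vec_space.col_space_eq[OF this(2)]
  fix y assume "y \<in> mrange (A * B)"
  then obtain x where x: "x \<in> carrier_vec (dim_col B)" "y = A * B *\<^sub>v x"
    using AB by auto
  then have "y = A *\<^sub>v (B *\<^sub>v x)"
    using assms by (metis assoc_mult_mat_vec carrier_matI)
  moreover have "A *\<^sub>v w \<in> carrier_vec (dim_row A)" "B *\<^sub>v w \<in> carrier_vec (dim_row B)" for w
    by (rule carrier_vecI, simp)+
  ultimately show "y \<in> mrange A"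
    using x assms by (auto simp: A intro!: bexI[of _ "B *\<^sub>v x"])
qed

lemma mrank_mult_le:
  assumes "dim_col A = dim_row B"
  shows "mrank (A * B) \<le> mrank A"
proof -
  interpret vec_space "TYPE(complex)" "dim_row A" .
  have AB: "A * B \<in> carrier_mat (dim_row A) (dim_col B)" and A: "A \<in> carrier_mat (dim_row A) (dim_col A)"
    using assms by auto
  have "span (set (cols (A * B))) \<subseteq> span (set (cols A))"
    using mrange_mult_subset[OF assms] by (simp add: col_space_def)
  moreover have s: "VectorSpace.subspace class_ring (span (set (cols A))) V"
      "VectorSpace.subspace class_ring (span (set (cols (A * B)))) V"
    using A AB cols_dim span_is_subspace by (metis carrier_matD(1))+
  ultimately have "VectorSpace.subspace class_ring (span (set (cols (A * B)))) (vs (span (set (cols A))))"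
    by (intro nested_subspaces) auto
  then show ?thesis
    using vectorspace.subspace_dim[OF subspace_is_vs[OF s(1)]] fin_dim_span_cols[OF A] fin_dim_span_cols[OF AB]
    by (simp add: rank_def)
qed

lemma mrank_le_dim_col: "mrank A \<le> dim_col A"
  by (rule vec_space.rank_le_nc) auto

lemma mrank_left_inverse:
  assumes "dim_col L = dim_row X" "L * X = 1\<^sub>m (dim_col X)"
  shows "mrank X = dim_col X"
proof -
  interpret vec_space "TYPE(complex)" "dim_row X" .
  have X: "X \<in> carrier_mat (dim_row X) (dim_col X)" and L: "L \<in> carrier_mat (dim_col X) (dim_row X)"
    using assms by (auto intro!: carrier_matI dest: arg_cong[of _ _ dim_row])
  have inj: "v = L *\<^sub>v (X *\<^sub>v v)" if "v \<in> carrier_vec (dim_col X)" for v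
    using assoc_mult_mat_vec[OF L X that] assms(2) that by simp
  \<comment> \<open>Linear independence concerns the set of columns, so repeated columns must be
    excluded separately; \<open>L\<close> sends the columns to different unit vectors.\<close>
  have "distinct (cols X)"
    unfolding distinct_conv_nth
  proof (intro allI impI)
    fix i j assume "i < length (cols X)" "j < length (cols X)" "i \<noteq> j"
    then have i: "i < dim_col X" and j: "j < dim_col X" and "i \<noteq> j" by auto
    have "L *\<^sub>v col X i = unit_vec (dim_col X) i" if "i < dim_col X" for i
      by (metis L X assms(2) col_mult2 col_one that)
    then have "L *\<^sub>v col X i \<noteq> L *\<^sub>v col X j"
      using i j \<open>i \<noteq> j\<close> by (simp add: unit_vec_eq)
    then show "cols X ! i \<noteq> cols X ! j"
      using i j by auto
  qed
  moreover have "lin_indpt (set (cols X))"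
  proof
    assume "lin_dep (set (cols X))"
    then obtain v where v: "v \<in> carrier_vec (dim_col X)" "v \<noteq> 0\<^sub>v (dim_col X)" "X *\<^sub>v v = 0\<^sub>v (dim_row X)"
      using lin_depE[OF X _ \<open>distinct (cols X)\<close>] by blast
    have "L *\<^sub>v 0\<^sub>v (dim_row X) = 0\<^sub>v (dim_col X)" using L by (auto intro!: eq_vecI)
    then show False using inj[OF v(1)] v(2,3) by simp
  qed
  ultimately show ?thesis
    using lin_indpt_full_rank[OF X] by blast
qed

text \<open>\<open>A = X * Y\<close> bounds the rank of \<open>A\<close> by that of
  \<open>X\<close>, and \<open>X = A * R\<close> gives the reverse bound.\<close>

lemma has_rank_mrank:
  assumes "has_rank A r"
  shows "mrank A = r"
proof -
  obtain X Y L R where d [simp]: "dim_row X = dim_row A" "dim_col X = r" "dim_row Y = r"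
      "dim_col Y = dim_col A" "dim_row L = r" "dim_col L = dim_row A" "dim_row R = dim_col A" "dim_col R = r"
    and A: "X * Y = A" "L * X = 1\<^sub>m r" "Y * R = 1\<^sub>m r"
    using assms unfolding has_rank_def by blast
  have "mrank X = r" using mrank_left_inverse[of L X] A by simp
  moreover have "mrank A \<le> mrank X" using mrank_mult_le[of X Y] A(1) by simp
  moreover have "A * R = X" unfolding A(1)[symmetric] by (simp add: mult_assoc_mat mult_one_mat A(3))
  then have "mrank X \<le> mrank A" using mrank_mult_le[of A R] by simp
  ultimately show ?thesis by simp
qed

text \<open>The block row of \<open>P\<close> and \<open>Q\<close> times the block column of
  \<open>P\<^sup>H\<close> and \<open>- Q\<^sup>H\<close> is a full rank factorization, with
  one-sided inverses built from \<open>K\<close>, \<open>L\<close> and their adjoints.\<close>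

lemma has_inertia_rank:
  assumes "has_inertia A p q"
  shows "has_rank A (p + q)"
proof -
  obtain P Q K L where d [simp]: "dim_row P = dim_row A" "dim_col P = p" "dim_row Q = dim_row A"
      "dim_col Q = q" "dim_row K = p" "dim_col K = dim_row A" "dim_row L = q" "dim_col L = dim_row A"
    and A: "P * P\<^sup>H - Q * Q\<^sup>H = A" and e: "K * P = 1\<^sub>m p" "K * Q = 0\<^sub>m p q" "L * P = 0\<^sub>m q p" "L * Q = 1\<^sub>m q"
    using assms unfolding has_inertia_def by blast
  have e': "P\<^sup>H * K\<^sup>H = 1\<^sub>m p" "Q\<^sup>H * K\<^sup>H = 0\<^sub>m q p" "P\<^sup>H * L\<^sup>H = 0\<^sub>m p q" "Q\<^sup>H * L\<^sup>H = 1\<^sub>m q"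
    using e[THEN arg_cong[of _ _ mat_adjoint]] by simp_all
  have dA: "dim_col A = dim_row A" by (subst A[symmetric]) simp
  let ?X = "four_block_mat P Q (0\<^sub>m 0 p) (0\<^sub>m 0 q)"
  let ?Y = "four_block_mat (P\<^sup>H) (0\<^sub>m p 0) (- Q\<^sup>H) (0\<^sub>m q 0)"
  let ?L = "four_block_mat K (0\<^sub>m p 0) L (0\<^sub>m q 0)"
  let ?R = "four_block_mat (K\<^sup>H) (- L\<^sup>H) (0\<^sub>m 0 p) (0\<^sub>m 0 q)"
  have "?X * ?Y = A"
    unfolding A[symmetric] by (rule mat_eq_entrywiseI) (simp_all add: mat_ring del: index_mult_mat(1))
  moreover have "?L * ?X = 1\<^sub>m (p + q)" "?Y * ?R = 1\<^sub>m (p + q)"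
    by (simp_all add: mat_ring e e')
  ultimately show ?thesis
    unfolding has_rank_def using dA
    by (intro exI[of _ ?X] exI[of _ ?Y] exI[of _ ?L] exI[of _ ?R]) simp
qed

lemma has_inertia_uminus: "has_inertia A p q \<Longrightarrow> has_inertia (- A) q p"
proof -
  assume "has_inertia A p q"
  then obtain P Q K L where d [simp]: "dim_row P = dim_row A" "dim_col P = p" "dim_row Q = dim_row A"
      "dim_col Q = q" "dim_row K = p" "dim_col K = dim_row A" "dim_row L = q" "dim_col L = dim_row A"
    and A: "P * P\<^sup>H - Q * Q\<^sup>H = A" and e: "K * P = 1\<^sub>m p" "K * Q = 0\<^sub>m p q" "L * P = 0\<^sub>m q p" "L * Q = 1\<^sub>m q"
    unfolding has_inertia_def by blast
  have "Q * Q\<^sup>H - P * P\<^sup>H = - A"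
    by (subst A[symmetric], rule mat_eq_entrywiseI) (simp_all del: index_mult_mat(1))
  then show ?thesis
    unfolding has_inertia_def using e
    by (intro exI[of _ Q] exI[of _ P] exI[of _ L] exI[of _ K]) simp
qed

text \<open>\<open>T\<close> acts on \<open>P\<close> and \<open>Q\<close>, and the left inverse
  \<open>U\<close> is absorbed into \<open>K\<close> and \<open>L\<close>. So \<open>T\<close> may
  also be a tall matrix.\<close>

lemma has_inertia_congruence:
  assumes "has_inertia A p q" "dim_row U = dim_row A" "dim_col U = dim_row T" "dim_col T = dim_row A"
    "U * T = 1\<^sub>m (dim_row A)"
  shows "has_inertia (T * A * T\<^sup>H) p q"
proof -
  obtain P Q K L where d [simp]: "dim_row P = dim_row A" "dim_col P = p" "dim_row Q = dim_row A"
      "dim_col Q = q" "dim_row K = p" "dim_col K = dim_row A" "dim_row L = q" "dim_col L = dim_row A"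
    and A: "P * P\<^sup>H - Q * Q\<^sup>H = A" and e: "K * P = 1\<^sub>m p" "K * Q = 0\<^sub>m p q" "L * P = 0\<^sub>m q p" "L * Q = 1\<^sub>m q"
    using assms(1) unfolding has_inertia_def by blast
  note [simp] = assms(2-4)
  have "(T * P) * (T * P)\<^sup>H - (T * Q) * (T * Q)\<^sup>H = T * A * T\<^sup>H"
    by (subst A[symmetric]) (simp add: mat_ring)
  then show ?thesis
    unfolding has_inertia_def using e assms(5)
    by (intro exI[of _ "T * P"] exI[of _ "T * Q"] exI[of _ "K * U"] exI[of _ "L * U"])
      (simp add: mat_ring mult_assoc_eq[OF assms(5)])
qed

lemma has_inertia_block_diag:
  assumes "has_inertia A p q" "has_inertia B p' q'"
  shows "has_inertia (four_block_mat A (0\<^sub>m (dim_row A) (dim_row B)) (0\<^sub>m (dim_row B) (dim_row A)) B) (p + p') (q + q')"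
proof -
  obtain P Q K L where d [simp]: "dim_row P = dim_row A" "dim_col P = p" "dim_row Q = dim_row A"
      "dim_col Q = q" "dim_row K = p" "dim_col K = dim_row A" "dim_row L = q" "dim_col L = dim_row A"
    and A: "P * P\<^sup>H - Q * Q\<^sup>H = A" and e: "K * P = 1\<^sub>m p" "K * Q = 0\<^sub>m p q" "L * P = 0\<^sub>m q p" "L * Q = 1\<^sub>m q"
    using assms(1) unfolding has_inertia_def by blast
  obtain P' Q' K' L' where d' [simp]: "dim_row P' = dim_row B" "dim_col P' = p'" "dim_row Q' = dim_row B"
      "dim_col Q' = q'" "dim_row K' = p'" "dim_col K' = dim_row B" "dim_row L' = q'" "dim_col L' = dim_row B"
    and B: "P' * P'\<^sup>H - Q' * Q'\<^sup>H = B"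
    and e': "K' * P' = 1\<^sub>m p'" "K' * Q' = 0\<^sub>m p' q'" "L' * P' = 0\<^sub>m q' p'" "L' * Q' = 1\<^sub>m q'"
    using assms(2) unfolding has_inertia_def by blast
  let ?d = "\<lambda>X Y. four_block_mat X (0\<^sub>m (dim_row X) (dim_col Y)) (0\<^sub>m (dim_row Y) (dim_col X)) Y"
  have "dim_col A = dim_row A" "dim_col B = dim_row B" by (subst A[symmetric], simp) (subst B[symmetric], simp)
  then have "?d P P' * (?d P P')\<^sup>H - ?d Q Q' * (?d Q Q')\<^sup>H
      = four_block_mat A (0\<^sub>m (dim_row A) (dim_row B)) (0\<^sub>m (dim_row B) (dim_row A)) B"
    unfolding A[symmetric] B[symmetric]
    by (intro mat_eq_entrywiseI) (simp_all add: mat_ring del: index_mult_mat(1))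
  then show ?thesis
    unfolding has_inertia_def using e e'
    by (intro exI[of _ "?d P P'"] exI[of _ "?d Q Q'"] exI[of _ "?d K K'"] exI[of _ "?d L L'"])
      (simp add: mat_ring)
qed

lemma has_inertia_zero: "has_inertia (0\<^sub>m n n) 0 0"
  unfolding has_inertia_def
  by (intro exI[of _ "0\<^sub>m n 0"] exI[of _ "0\<^sub>m 0 n"]) (auto intro!: eq_matI simp: mat_ring)

section \<open>The spectral theorem\<close>

text \<open>Basis completion and Gram-Schmidt give an orthogonal basis that starts with
  \<open>v\<close>; its normalized members are the columns of \<open>U\<close>.\<close>

lemma unitary_completion:
  fixes v :: "complex vec"
  assumes v: "v \<in> carrier_vec n" and v0: "v \<noteq> 0\<^sub>v n"
  obtains U c where "U \<in> carrier_mat n n" "U\<^sup>H * U = 1\<^sub>m n" "U * U\<^sup>H = 1\<^sub>m n" "col U 0 = c \<cdot>\<^sub>v v"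
proof -
  interpret cof_vec_space n "TYPE(complex)" .
  define b where "b = basis_completion v"
  define ws where "ws = gram_schmidt n b"
  from basis_completion[OF v v0, folded b_def]
  have dist_b: "distinct b" and indep: "\<not> lin_dep (set b)" and b: "set b \<subseteq> carrier_vec n"
    and hdb: "hd b = v" and len_b: "length b = n" by auto
  have n: "n \<noteq> 0" using v v0 by (cases n) auto
  from hdb len_b n obtain vs where bv: "b = v # vs" by (cases b) auto
  from gram_schmidt_result[OF b dist_b indep refl, folded ws_def]
  have ws: "set ws \<subseteq> carrier_vec n" "corthogonal ws" "length ws = n"
    by (auto simp: len_b)
  from gram_schmidt_hd[OF v, of vs, folded bv] have hdws: "hd ws = v" unfolding ws_def .
  have wsc: "ws ! i \<in> carrier_vec n" if "i < n" for i using ws that by auto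
  define s where "s i = complex_of_real (1 / sqrt (Re (ws ! i \<bullet>c ws ! i)))" for i
  define U where "U = mat n n (\<lambda>(i, j). s j * ws ! j $ i)"
  have U: "U \<in> carrier_mat n n" by (simp add: U_def)
  have entry: "(U\<^sup>H * U) $$ (i, j) = (if i = j then 1 else 0)" if i: "i < n" and j: "j < n" for i j
  proof -
    have "(U\<^sup>H * U) $$ (i, j) = cnj (s i) * s j * (ws ! j \<bullet>c ws ! i)"
      using i j wsc[OF i] wsc[OF j]
      by (simp add: U_def scalar_prod_def sum_distrib_left algebra_simps)
    also have "\<dots> = (if i = j then 1 else 0)"
    proof (cases "i = j")
      case True
      let ?r = "ws ! i \<bullet>c ws ! i"
      \<comment> \<open>\<open>corthogonal\<close> includes that no member has norm zero, so the
        normalizing factor \<open>s i\<close> is meaningful.\<close>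
      have "?r > 0"
        using corthogonalD[OF ws(2), of i i] conjugate_square_ge_0_vec[of "ws ! i"] i ws(3)
        by (simp add: less_le)
      then have "?r = complex_of_real (Re ?r)" "Re ?r > 0"
        by (auto simp: less_complex_def complex_eq_iff)
      moreover from this(2) have "cnj (s i) * s i = complex_of_real (1 / Re ?r)"
        by (simp add: s_def flip: of_real_mult)
      ultimately have "cnj (s i) * s i * ?r = complex_of_real (1 / Re ?r * Re ?r)"
        by (metis of_real_mult)
      then show ?thesis using True \<open>Re ?r > 0\<close> by simp
    next
      case False
      then show ?thesis using corthogonalD[OF ws(2), of j i] i j ws(3) by simp
    qed
    finally show ?thesis .
  qed
  have UU: "U\<^sup>H * U = 1\<^sub>m n"
    by (rule mat_eq_entrywiseI) (use U entry in \<open>auto simp del: index_mult_mat(1)\<close>)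
  moreover have "U * U\<^sup>H = 1\<^sub>m n"
    using mat_mult_left_right_inverse[OF carrier_adj[OF U] U UU] .
  moreover have "ws ! 0 = v" using hdws ws n by (metis hd_conv_nth length_greater_0_conv neq0_conv)
  then have "col U 0 = s 0 \<cdot>\<^sub>v v"
    using n v by (intro eq_vecI) (auto simp: U_def)
  ultimately show ?thesis using U that by blast
qed

lemma has_inertia_1x1:
  assumes "Im e = 0"
  shows "has_inertia (mat 1 1 (\<lambda>_. e)) (if 0 < e then 1 else 0) (if e < 0 then 1 else 0)"
proof -
  have pos: "has_inertia (mat 1 1 (\<lambda>_. complex_of_real x)) 1 0" if "x > 0" for x
  proof -
    let ?m = "\<lambda>x. mat 1 1 (\<lambda>_. complex_of_real x)"
    have 1: "?m x * ?m y = ?m (x * y)" for x y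
      by (rule eq_matI) (auto simp: scalar_prod_def)
    have 2: "(?m x)\<^sup>H = ?m x" for x by (rule eq_matI) auto
    have 3: "?m 1 = 1\<^sub>m 1" by (rule eq_matI) auto
    \<comment> \<open>With an empty \<open>Q\<close> the product \<open>L * Q\<close> is an empty
      zero matrix, which has to be recognized as the empty identity.\<close>
    have "1\<^sub>m 0 = (0\<^sub>m 0 0 :: complex mat)" by (rule eq_matI) auto
    moreover have "?m (sqrt x) * (?m (sqrt x))\<^sup>H = ?m x" "?m (1 / sqrt x) * ?m (sqrt x) = 1\<^sub>m 1"
      using that unfolding 1 2 3[symmetric] by simp_all
    ultimately show ?thesis
      unfolding has_inertia_def
      by (intro exI[of _ "?m (sqrt x)"] exI[of _ "0\<^sub>m 1 0"] exI[of _ "?m (1 / sqrt x)"] exI[of _ "0\<^sub>m 0 1"])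
        (simp add: mat_ring del: One_nat_def of_real_divide)
  qed
  have e: "e = complex_of_real (Re e)" using assms by (simp add: complex_eq_iff)
  consider "Re e > 0" | "Re e = 0" | "Re e < 0" by linarith
  then show ?thesis
  proof cases
    case 1
    then have "0 < e" "\<not> e < 0" using assms by (auto simp: less_complex_def)
    then show ?thesis using pos[OF 1] e by simp
  next
    case 2
    then have "e = 0" using e by simp
    moreover have "mat 1 1 (\<lambda>_. 0 :: complex) = 0\<^sub>m 1 1" by (rule eq_matI) auto
    ultimately show ?thesis using has_inertia_zero[of 1] by simp
  next
    case 3
    then have "e < 0" "\<not> 0 < e" using assms by (auto simp: less_complex_def)
    moreover have "- mat 1 1 (\<lambda>_. complex_of_real (- Re e)) = mat 1 1 (\<lambda>_. e)"
      by (rule eq_matI) (use e in auto)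
    ultimately show ?thesis using has_inertia_uminus[OF pos[of "- Re e"]] 3 by simp
  qed
qed

text \<open>Root multisets of nonzero polynomials add under multiplication, so a split-off linear
  factor contributes according to the sign of its root.\<close>

lemma inertia_eigenvalue_block:
  assumes "A3 \<in> carrier_mat n n"
    and cp: "char_poly A = [:- e, 1:] * char_poly A3"
  shows "pos_inertia A = (if 0 < e then 1 else 0) + pos_inertia A3"
    and "neg_inertia A = (if e < 0 then 1 else 0) + neg_inertia A3"
proof -
  have "char_poly A3 \<noteq> 0" using degree_monic_char_poly[OF assms(1)] by auto
  then have "proots (char_poly A) = {#e#} + proots (char_poly A3)"
    unfolding cp by (subst proots_mult) auto
  then show "pos_inertia A = (if 0 < e then 1 else 0) + pos_inertia A3"
    "neg_inertia A = (if e < 0 then 1 else 0) + neg_inertia A3"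
    by (auto simp: pos_inertia_def neg_inertia_def)
qed

text \<open>Deflation: a unitary matrix whose first column is an eigenvector splits off a 1 x 1
  block, and the induction hypothesis treats the Hermitian rest.\<close>

lemma hermitian_has_inertia:
  assumes "A \<in> herm_mats n"
  shows "has_inertia A (pos_inertia A) (neg_inertia A)"
  using assms
proof (induction n arbitrary: A)
  case 0
  then have A: "A \<in> carrier_mat 0 0" by (simp add: herm_mats_def)
  then have "char_poly A = 1"
    using degree_monic_char_poly[OF A] by (metis monic_degree_0)
  moreover have "A = 0\<^sub>m 0 0" using A by (intro eq_matI) auto
  ultimately show ?case using has_inertia_zero[of 0] by (simp add: pos_inertia_def neg_inertia_def)
next
  case (Suc n)
  then have A: "A \<in> carrier_mat (Suc n) (Suc n)" and herm: "A\<^sup>H = A" by (auto simp: herm_mats_def)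
  obtain es where es: "char_poly A = (\<Prod>a\<leftarrow>es. [:- a, 1:])" "length es = Suc n"
    using char_poly_factorized[OF A] by blast
  then obtain e es' where "es = e # es'" by (cases es) auto
  then have "eigenvalue A e" using es by (simp add: eigenvalue_root_char_poly[OF A])
  then obtain v where v: "v \<in> carrier_vec (Suc n)" "v \<noteq> 0\<^sub>v (Suc n)" "A *\<^sub>v v = e \<cdot>\<^sub>v v"
    using A by (auto simp: eigenvalue_def eigenvector_def)
  obtain U c where U: "U \<in> carrier_mat (Suc n) (Suc n)" and UU: "U\<^sup>H * U = 1\<^sub>m (Suc n)" "U * U\<^sup>H = 1\<^sub>m (Suc n)"
    and col0: "col U 0 = c \<cdot>\<^sub>v v"
    using unitary_completion[OF v(1,2)] .
  have d [simp]: "dim_row A = Suc n" "dim_col A = Suc n" "dim_row U = Suc n" "dim_col U = Suc n"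
    using A U by auto
  define A' where "A' = U\<^sup>H * (A * U)"
  have A': "A' \<in> carrier_mat (Suc n) (Suc n)" by (auto simp: A'_def)
  then have d' [simp]: "dim_row A' = Suc n" "dim_col A' = Suc n" by auto
  have herm': "A'\<^sup>H = A'" by (simp add: A'_def herm mat_ring)
  have "A *\<^sub>v col U 0 = e \<cdot>\<^sub>v col U 0"
    using v(3) mult_mat_vec[OF A v(1)] unfolding col0
    by (simp add: smult_smult_assoc mult.commute)
  then have AU: "col (A * U) 0 = e \<cdot>\<^sub>v col U 0"
    using col_mult2[OF A U, of 0] by simp
  have A'0: "A' $$ (i, 0) = (if i = 0 then e else 0)" if i: "i < Suc n" for i
  proof -
    have "A' $$ (i, 0) = e * (U\<^sup>H * U) $$ (i, 0)"
      using i by (simp add: A'_def AU)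
    then show ?thesis using i by (simp add: UU)
  qed
  \<comment> \<open>Hermitian symmetry carries the zeros of the first column over to the first row;
    comparing the two values of the corner entry then shows that \<open>e\<close> is real.\<close>
  have A'0': "A' $$ (0, j) = (if j = 0 then cnj e else 0)" if "j < Suc n" for j
    using that A'0[OF that] index_adj[of 0 A' j] herm' by simp
  have e: "Im e = 0" using A'0[of 0] A'0'[of 0] by (simp add: complex_eq_iff)
  define A3 where "A3 = mat n n (\<lambda>(i, j). A' $$ (Suc i, Suc j))"
  have A3: "A3 \<in> carrier_mat n n" by (simp add: A3_def)
  have "A3\<^sup>H = A3"
  proof (rule mat_eq_entrywiseI)
    fix i j assume "i < dim_row (A3\<^sup>H)" "j < dim_col (A3\<^sup>H)"
    then show "A3\<^sup>H $$ (i, j) = A3 $$ (i, j)"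
      using index_adj[of "Suc i" A' "Suc j"] herm' by (simp add: A3_def)
  qed (simp_all add: A3_def)
  then have A3h: "A3 \<in> herm_mats n" using A3 by (simp add: herm_mats_def)
  let ?E = "mat 1 1 (\<lambda>_. e)"
  have block: "A' = four_block_mat ?E (0\<^sub>m 1 n) (0\<^sub>m n 1) A3"
    by (rule mat_eq_entrywiseI) (use e in \<open>auto simp: A3_def A'0 A'0' complex_eq_iff\<close>)
  have "similar_mat A' A"
    unfolding similar_mat_def
    by (intro exI[of _ "U\<^sup>H"] exI[of _ U] similar_mat_witI[of _ _ "Suc n"])
      (use U A A' UU in \<open>auto simp: A'_def mat_ring\<close>)
  then have "char_poly A = char_poly A'" by (simp add: char_poly_similar)
  also have "\<dots> = char_poly ?E * char_poly A3"
    unfolding block by (rule char_poly_four_block_zeros_col[OF _ _ A3]) auto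
  also have "char_poly ?E = [:- e, 1:]"
    by (simp add: char_poly_defs det_def sign_def)
  finally have cp: "char_poly A = [:- e, 1:] * char_poly A3" .
  have "has_inertia A' (pos_inertia A) (neg_inertia A)"
    using has_inertia_block_diag[OF has_inertia_1x1[OF e] Suc.IH[OF A3h]] A3
    unfolding inertia_eigenvalue_block[OF A3 cp] block by simp
  from has_inertia_congruence[OF this, of "U\<^sup>H" U]
  have "has_inertia (U * A' * U\<^sup>H) (pos_inertia A) (neg_inertia A)" by (simp add: UU)
  also have "U * A' * U\<^sup>H = A"
    by (simp add: A'_def mat_ring UU mult_assoc_eq[OF UU(2)])
  finally show ?case .
qed

section \<open>Sylvester's law of inertia and full rank factorizations\<close>

lemma inner_adj:
  fixes A :: "complex mat"
  assumes v: "v \<in> carrier_vec (dim_col A)" and w: "w \<in> carrier_vec (dim_row A)"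
  shows "(A *\<^sub>v v) \<bullet>c w = v \<bullet>c (A\<^sup>H *\<^sub>v w)"
proof -
  have "(A *\<^sub>v v) \<bullet>c w = (\<Sum>i<dim_row A. \<Sum>j<dim_col A. A $$ (i, j) * v $ j * cnj (w $ i))"
    using v w by (simp add: scalar_prod_def sum_distrib_right atLeast0LessThan)
  also have "\<dots> = (\<Sum>j<dim_col A. \<Sum>i<dim_row A. A $$ (i, j) * v $ j * cnj (w $ i))"
    by (rule sum.swap)
  also have "\<dots> = v \<bullet>c (A\<^sup>H *\<^sub>v w)"
    using v w by (simp add: scalar_prod_def sum_distrib_left atLeast0LessThan mult_ac)
  finally show ?thesis .
qed

lemma gram_form:
  fixes B :: "complex mat"
  assumes "v \<in> carrier_vec (dim_row B)"
  shows "(B * B\<^sup>H *\<^sub>v v) \<bullet>c v = (B\<^sup>H *\<^sub>v v) \<bullet>c (B\<^sup>H *\<^sub>v v)"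
proof -
  have c: "B\<^sup>H *\<^sub>v v \<in> carrier_vec (dim_col B)" by (rule carrier_vecI) simp
  have "B * B\<^sup>H *\<^sub>v v = B *\<^sub>v (B\<^sup>H *\<^sub>v v)"
    using assms by (metis assoc_mult_mat_vec carrier_mat_triv carrier_adj)
  then show ?thesis using inner_adj[OF c assms] by simp
qed

text \<open>The diagonal entries of \<open>B * B\<^sup>H\<close> are the squared norms of the rows
  of \<open>B\<close>.\<close>

lemma gram_eq_zero:
  fixes B :: "complex mat"
  assumes "B * B\<^sup>H = 0\<^sub>m (dim_row B) (dim_row B)"
  shows "B = 0\<^sub>m (dim_row B) (dim_col B)"
proof (rule mat_eq_entrywiseI)
  fix i j assume i: "i < dim_row B" and j: "j < dim_col B"
  have "row B i \<bullet>c row B i = (B * B\<^sup>H) $$ (i, i)"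
    using i by (simp add: scalar_prod_def)
  then have "row B i = 0\<^sub>v (dim_col B)"
    using i assms conjugate_square_eq_0_vec[of "row B i" "dim_col B"] by simp
  then show "B $$ (i, j) = 0\<^sub>m (dim_row B) (dim_col B) $$ (i, j)"
    using i j by (metis index_row(1) index_zero_mat(1) index_zero_vec(1))
qed simp_all

lemma mrank_det:
  assumes "A \<in> carrier_mat n n"
  shows "det A \<noteq> 0 \<longleftrightarrow> mrank A = n"
  using vec_space.det_rank_iff[OF assms] assms by auto

text \<open>Compression by \<open>K\<close> turns the first representation into the identity and the
  second into \<open>W * W\<^sup>H - Z * Z\<^sup>H\<close>. Hence \<open>W * W\<^sup>H\<close> is
  the identity plus a Gram matrix and has rank \<open>p\<close>, but \<open>W\<close> has only
  \<open>p'\<close> columns.\<close>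

lemma has_inertia_pos_le:
  assumes "has_inertia A p q" "has_inertia A p' q'"
  shows "p \<le> p'"
proof -
  obtain P Q K L where d [simp]: "dim_row P = dim_row A" "dim_col P = p" "dim_row Q = dim_row A"
      "dim_col Q = q" "dim_row K = p" "dim_col K = dim_row A" "dim_row L = q" "dim_col L = dim_row A"
    and A: "P * P\<^sup>H - Q * Q\<^sup>H = A" and e: "K * P = 1\<^sub>m p" "K * Q = 0\<^sub>m p q" "L * P = 0\<^sub>m q p" "L * Q = 1\<^sub>m q"
    using assms(1) unfolding has_inertia_def by blast
  obtain P' Q' where d' [simp]: "dim_row P' = dim_row A" "dim_col P' = p'" "dim_row Q' = dim_row A"
      "dim_col Q' = q'" and A': "P' * P'\<^sup>H - Q' * Q'\<^sup>H = A"
    using assms(2) unfolding has_inertia_def by metis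
  have dA: "dim_col A = dim_row A" by (subst A[symmetric]) simp
  define W where "W = K * P'"
  define Z where "Z = K * Q'"
  have [simp]: "dim_row W = p" "dim_col W = p'" "dim_row Z = p" "dim_col Z = q'" by (simp_all add: W_def Z_def)
  have "W * W\<^sup>H - Z * Z\<^sup>H = K * (P' * P'\<^sup>H - Q' * Q'\<^sup>H) * K\<^sup>H"
    by (simp add: W_def Z_def mat_ring)
  also have "\<dots> = K * (P * P\<^sup>H - Q * Q\<^sup>H) * K\<^sup>H" by (simp only: A A')
  also have "\<dots> = (K * P) * (K * P)\<^sup>H - (K * Q) * (K * Q)\<^sup>H" by (simp add: mat_ring)
  also have "\<dots> = 1\<^sub>m p" by (simp add: e mat_ring)
  finally have *: "W * W\<^sup>H - Z * Z\<^sup>H = 1\<^sub>m p" .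
  have W: "W * W\<^sup>H = 1\<^sub>m p + Z * Z\<^sup>H"
  proof (rule mat_eq_entrywiseI)
    fix i j assume ij: "i < dim_row (W * W\<^sup>H)" "j < dim_col (W * W\<^sup>H)"
    have "(W * W\<^sup>H - Z * Z\<^sup>H) $$ (i, j) = 1\<^sub>m p $$ (i, j)" by (simp only: *)
    then show "(W * W\<^sup>H) $$ (i, j) = (1\<^sub>m p + Z * Z\<^sup>H) $$ (i, j)"
      using ij by (simp add: algebra_simps del: index_mult_mat(1))
  qed simp_all
  \<comment> \<open>A kernel vector v would satisfy |v|^2 + |Z* v|^2 = 0.\<close>
  have "det (W * W\<^sup>H) \<noteq> 0"
  proof
    assume "det (W * W\<^sup>H) = 0"
    then obtain v where v: "v \<in> carrier_vec p" "v \<noteq> 0\<^sub>v p" "W * W\<^sup>H *\<^sub>v v = 0\<^sub>v p"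
      using det_0_iff_vec_prod_zero_field[of "W * W\<^sup>H" p] by (auto simp: carrier_matI)
    have "W * W\<^sup>H *\<^sub>v v = v + (Z * Z\<^sup>H) *\<^sub>v v"
      unfolding W using v(1) by (subst add_mult_distrib_mat_vec[of _ p p]) (auto simp: carrier_matI)
    moreover have "(W * W\<^sup>H *\<^sub>v v) \<bullet>c v = 0" using v by simp
    ultimately have "(v + (Z * Z\<^sup>H) *\<^sub>v v) \<bullet>c v = 0" by simp
    moreover have "(v + (Z * Z\<^sup>H) *\<^sub>v v) \<bullet>c v = v \<bullet>c v + ((Z * Z\<^sup>H) *\<^sub>v v) \<bullet>c v"
      by (rule add_scalar_prod_distrib[of _ p]) (use v in \<open>auto intro!: carrier_vecI\<close>)
    ultimately have "v \<bullet>c v + (Z\<^sup>H *\<^sub>v v) \<bullet>c (Z\<^sup>H *\<^sub>v v) = 0"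
      using gram_form[of v Z] v(1) by simp
    moreover have "v \<bullet>c v > 0" using v by simp
    ultimately show False
      using conjugate_square_ge_0_vec[of "Z\<^sup>H *\<^sub>v v"] by (metis add_pos_nonneg less_irrefl)
  qed
  then have "mrank (W * W\<^sup>H) = p" using mrank_det[of "W * W\<^sup>H" p] by (auto simp: carrier_matI)
  then show ?thesis using mrank_mult_le[of W "W\<^sup>H"] mrank_le_dim_col[of W] by simp
qed

lemma has_inertia_herm:
  assumes "has_inertia A p q"
  shows "A \<in> herm_mats (dim_row A)"
proof -
  obtain P Q where d: "dim_row P = dim_row A" "dim_row Q = dim_row A" and A: "P * P\<^sup>H - Q * Q\<^sup>H = A"
    using assms unfolding has_inertia_def by metis
  from d have "(P * P\<^sup>H - Q * Q\<^sup>H)\<^sup>H = P * P\<^sup>H - Q * Q\<^sup>H" "dim_col (P * P\<^sup>H - Q * Q\<^sup>H) = dim_row A"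
    by simp_all
  then show ?thesis unfolding A herm_mats_def by auto
qed

text \<open>The eigenvalue counts are one admissible pair by the spectral theorem. Comparing it with
  the given pair in both directions, for \<open>A\<close> and for \<open>- A\<close>, forces
  equality.\<close>

lemma sylvester_inertia:
  assumes "has_inertia A p q"
  shows "pos_inertia A = p" "neg_inertia A = q" "mrank A = p + q"
proof -
  note A = hermitian_has_inertia[OF has_inertia_herm[OF assms]]
  show "pos_inertia A = p"
    using has_inertia_pos_le[OF A assms] has_inertia_pos_le[OF assms A] by simp
  show "neg_inertia A = q"
    using has_inertia_pos_le[OF has_inertia_uminus[OF A] has_inertia_uminus[OF assms]]
      has_inertia_pos_le[OF has_inertia_uminus[OF assms] has_inertia_uminus[OF A]] by simp
  show "mrank A = p + q"
    by (rule has_rank_mrank[OF has_inertia_rank[OF assms]])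
qed

text \<open>\<open>A * A\<^sup>H\<close> has the range of \<open>A\<close>, so the factor
  \<open>P\<close> in its representation \<open>P * P\<^sup>H\<close> also serves as the left factor
  of \<open>A\<close>.\<close>

lemma has_rank_exists: "\<exists>r. has_rank A r"
proof -
  have "A * A\<^sup>H \<in> herm_mats (dim_row A)"
    by (auto simp: herm_mats_def intro!: carrier_matI)
  from hermitian_has_inertia[OF this] obtain p q where "has_inertia (A * A\<^sup>H) p q" by blast
  then obtain P Q K L where d [simp]: "dim_row P = dim_row A" "dim_col P = p" "dim_row Q = dim_row A"
      "dim_col Q = q" "dim_row K = p" "dim_col K = dim_row A" "dim_row L = q" "dim_col L = dim_row A"
    and A: "P * P\<^sup>H - Q * Q\<^sup>H = A * A\<^sup>H" and e: "K * P = 1\<^sub>m p" "K * Q = 0\<^sub>m p q" "L * P = 0\<^sub>m q p" "L * Q = 1\<^sub>m q"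
    unfolding has_inertia_def by auto
  \<comment> \<open>Compressing \<open>A * A\<^sup>H\<close> by \<open>L\<close> gives a Gram matrix
    equal to minus the identity. Its diagonal must be nonnegative, so it has to be empty.\<close>
  have LA: "(L * A) * (L * A)\<^sup>H = - 1\<^sub>m q"
  proof -
    have "(L * A) * (L * A)\<^sup>H = L * (A * A\<^sup>H) * L\<^sup>H" by (simp add: mat_ring)
    also have "\<dots> = (L * P) * (L * P)\<^sup>H - (L * Q) * (L * Q)\<^sup>H" unfolding A[symmetric] by (simp add: mat_ring)
    also have "\<dots> = - 1\<^sub>m q" unfolding e by (rule mat_eq_entrywiseI) (simp_all add: mat_ring)
    finally show ?thesis .
  qed
  have "q = 0"
  proof (rule ccontr)
    assume q: "q \<noteq> 0"
    have "row (L * A) 0 \<bullet>c row (L * A) 0 = ((L * A) * (L * A)\<^sup>H) $$ (0, 0)"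
      using q by (simp add: scalar_prod_def del: adj_mult)
    also have "\<dots> = -1" using q by (simp only: LA) simp
    finally show False using conjugate_square_ge_0_vec[of "row (L * A) 0"] by (simp add: less_eq_complex_def)
  qed
  then have "Q * Q\<^sup>H = 0\<^sub>m (dim_row A) (dim_row A)" by (intro eq_matI) (simp_all add: scalar_prod_def)
  then have PP: "P * P\<^sup>H = A * A\<^sup>H" using A by (simp add: mat_ring)
  have KPP: "K * (P * P\<^sup>H) = P\<^sup>H" by (simp add: mult_assoc_eq[OF e(1)] mat_ring)
  \<comment> \<open>\<open>P * K\<close> acts as the identity on the range of \<open>A\<close>: the
    defect \<open>?D\<close> has Gram matrix zero.\<close>
  let ?D = "A - P * (K * A)"
  have "?D * ?D\<^sup>H = A * A\<^sup>H - A * A\<^sup>H * K\<^sup>H * P\<^sup>H - (P * (K * (A * A\<^sup>H)) - P * (K * (A * A\<^sup>H)) * K\<^sup>H * P\<^sup>H)"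
    by (rule mat_eq_entrywiseI) (simp_all add: mat_ring del: index_mult_mat(1))
  also have "\<dots> = P * P\<^sup>H - P * (K * P)\<^sup>H * P\<^sup>H - (P * P\<^sup>H - P * (K * P)\<^sup>H * P\<^sup>H)"
    unfolding PP[symmetric] KPP by (simp add: mat_ring)
  also have "\<dots> = 0\<^sub>m (dim_row A) (dim_row A)"
    by (rule mat_eq_entrywiseI) (simp_all add: e mat_ring)
  finally have "?D = 0\<^sub>m (dim_row A) (dim_col A)" using gram_eq_zero[of ?D] by simp
  note D0 = this
  have fact: "P * (K * A) = A"
  proof (rule mat_eq_entrywiseI)
    fix i j assume "i < dim_row (P * (K * A))" "j < dim_col (P * (K * A))"
    then show "(P * (K * A)) $$ (i, j) = A $$ (i, j)"
      using arg_cong[OF D0, of "\<lambda>M. M $$ (i, j)"] by (simp del: index_mult_mat(1))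
  qed simp_all
  have "(K * A) * (K * A)\<^sup>H = K * (A * A\<^sup>H) * K\<^sup>H" by (simp add: mat_ring)
  also have "\<dots> = (K * P) * (K * P)\<^sup>H" unfolding PP[symmetric] by (simp add: mat_ring)
  also have "\<dots> = 1\<^sub>m p" by (simp add: e mat_ring)
  finally have "(K * A) * (K * A)\<^sup>H = 1\<^sub>m p" .
  then have "has_rank A p"
    unfolding has_rank_def using fact e
    by (intro exI[of _ P] exI[of _ "K * A"] exI[of _ K] exI[of _ "(K * A)\<^sup>H"]) (simp del: adj_mult)
  then show ?thesis ..
qed

lemma has_rank_adj:
  assumes "has_rank A r"
  shows "has_rank (A\<^sup>H) r"
proof -
  obtain X Y L R where d [simp]: "dim_row X = dim_row A" "dim_col X = r" "dim_row Y = r"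
      "dim_col Y = dim_col A" "dim_row L = r" "dim_col L = dim_row A" "dim_row R = dim_col A" "dim_col R = r"
    and A: "X * Y = A" "L * X = 1\<^sub>m r" "Y * R = 1\<^sub>m r"
    using assms unfolding has_rank_def by blast
  have "Y\<^sup>H * X\<^sup>H = A\<^sup>H" "R\<^sup>H * Y\<^sup>H = 1\<^sub>m r" "X\<^sup>H * L\<^sup>H = 1\<^sub>m r"
    using A[THEN arg_cong[of _ _ mat_adjoint]] by simp_all
  then show ?thesis
    unfolding has_rank_def
    by (intro exI[of _ "Y\<^sup>H"] exI[of _ "X\<^sup>H"] exI[of _ "R\<^sup>H"] exI[of _ "L\<^sup>H"]) simp
qed

lemma has_rank_equiv:
  assumes "has_rank A r" and [simp]: "dim_row S' = dim_row A" "dim_col S' = dim_row S" "dim_col S = dim_row A"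
    "dim_row T = dim_col A" "dim_row T' = dim_col T" "dim_col T' = dim_col A"
    and S: "S' * S = 1\<^sub>m (dim_row A)" and T: "T * T' = 1\<^sub>m (dim_col A)"
  shows "has_rank (S * A * T) r"
proof -
  obtain X Y L R where d [simp]: "dim_row X = dim_row A" "dim_col X = r" "dim_row Y = r"
      "dim_col Y = dim_col A" "dim_row L = r" "dim_col L = dim_row A" "dim_row R = dim_col A" "dim_col R = r"
    and A: "X * Y = A" "L * X = 1\<^sub>m r" "Y * R = 1\<^sub>m r"
    using assms(1) unfolding has_rank_def by blast
  have "(S * X) * (Y * T) = S * A * T" unfolding A(1)[symmetric] by (simp add: mat_ring)
  then show ?thesis
    unfolding has_rank_def
    by (intro exI[of _ "S * X"] exI[of _ "Y * T"] exI[of _ "L * S'"] exI[of _ "T' * R"])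
      (simp add: mat_ring mult_assoc_eq[OF S] mult_assoc_eq[OF T] A(2,3))
qed

section \<open>Splitting along the kernel of a matrix\<close>

text \<open>The block row of \<open>R\<close>, \<open>F\<close> and the block column of
  \<open>Y\<close>, \<open>G\<close> are mutually inverse basis changes: x = R y + F g with y = Y x
  and g = G x. As \<open>X\<close> is injective, the columns of \<open>F\<close> are a basis of the
  kernel of \<open>B\<close>.\<close>

locale rank_split =
  fixes B X Y L R F G :: "complex mat" and m p r f :: nat
  assumes dims [simp]: "dim_row B = m" "dim_col B = p" "dim_row X = m" "dim_col X = r"
      "dim_row Y = r" "dim_col Y = p" "dim_row L = r" "dim_col L = m" "dim_row R = p" "dim_col R = r"
      "dim_row F = p" "dim_col F = f" "dim_row G = f" "dim_col G = p"
    and XY: "X * Y = B" and LX: "L * X = 1\<^sub>m r" and YR: "Y * R = 1\<^sub>m r"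
    and YF: "Y * F = 0\<^sub>m r f" and GR: "G * R = 0\<^sub>m f r" and GF: "G * F = 1\<^sub>m f"
    and RY_FG: "R * Y + F * G = 1\<^sub>m p"
begin

lemma adj_eqs: "Y\<^sup>H * X\<^sup>H = B\<^sup>H" "X\<^sup>H * L\<^sup>H = 1\<^sub>m r" "R\<^sup>H * Y\<^sup>H = 1\<^sub>m r" "F\<^sup>H * Y\<^sup>H = 0\<^sub>m f r"
  "R\<^sup>H * G\<^sup>H = 0\<^sub>m r f" "F\<^sup>H * G\<^sup>H = 1\<^sub>m f"
  using XY LX YR YF GR GF by (simp_all flip: adj_mult)

lemmas eqs = XY LX YR YF GR GF adj_eqs

lemmas split_simps = eqs eqs[THEN mult_assoc_eq]

lemma rank: "has_rank B r" "mrank B = r"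
proof -
  show "has_rank B r"
    unfolding has_rank_def
    by (intro exI[of _ X] exI[of _ Y] exI[of _ L] exI[of _ R]) (simp add: eqs)
  then show "mrank B = r" by (rule has_rank_mrank)
qed

text \<open>Rank-nullity: \<open>?S\<close> inverts \<open>?T\<close> on both sides, so the rank of
  \<open>?T\<close> is both its number of columns and \<open>p\<close>.\<close>

lemma dim_sum: "r + f = p"
proof -
  let ?T = "four_block_mat R F (0\<^sub>m 0 r) (0\<^sub>m 0 f)"
  let ?S = "four_block_mat Y (0\<^sub>m r 0) G (0\<^sub>m f 0)"
  have ST: "?S * ?T = 1\<^sub>m (r + f)" by (simp add: mat_ring eqs)
  have "?T * ?S = four_block_mat (1\<^sub>m p) (0\<^sub>m p 0) (0\<^sub>m 0 p) (1\<^sub>m 0)"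
    by (simp add: mat_ring RY_FG) (auto intro!: cong_four_block_mat eq_matI)
  then have TS: "?T * ?S = 1\<^sub>m p" by simp
  have 1: "mrank (1\<^sub>m p) = p" using mrank_left_inverse[of "1\<^sub>m p" "1\<^sub>m p"] by (simp add: mat_ring)
  have "mrank ?T = r + f" using mrank_left_inverse[of ?S ?T] ST by simp
  moreover have "mrank (?T * ?S) \<le> mrank ?T" by (rule mrank_mult_le) simp
  moreover have "mrank (1\<^sub>m p * ?T) \<le> mrank (1\<^sub>m p)" by (rule mrank_mult_le) simp
  moreover have "1\<^sub>m p * ?T = ?T" by (rule one_mult_mat) simp
  ultimately show ?thesis using 1 TS by simp
qed

text \<open>In the basis given by \<open>F\<close> and \<open>R\<close> the stacked matrix becomes
  [U F, U R; 0, X]. Since \<open>L * X\<close> is the identity, row operations with \<open>L\<close>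
  clear \<open>U * R\<close>.\<close>

lemma has_rank_append:
  assumes "dim_col U = p" "has_rank (U * F) t"
  shows "has_rank (U @\<^sub>r B) (t + r)"
proof -
  note [simp] = assms(1)
  obtain X1 Y1 L1 R1 where d [simp]: "dim_row X1 = dim_row U" "dim_col X1 = t" "dim_row Y1 = t"
      "dim_col Y1 = f" "dim_row L1 = t" "dim_col L1 = dim_row U" "dim_row R1 = f" "dim_col R1 = t"
    and UF: "X1 * Y1 = U * F" and e: "L1 * X1 = 1\<^sub>m t" "Y1 * R1 = 1\<^sub>m t"
    using assms(2) unfolding has_rank_def by auto
  let ?X = "four_block_mat X1 (U * R) (0\<^sub>m m t) X"
  let ?Y = "four_block_mat (Y1 * G) (0\<^sub>m t 0) Y (0\<^sub>m r 0)"
  let ?L = "four_block_mat L1 (- (L1 * (U * (R * L)))) (0\<^sub>m r (dim_row U)) L"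
  let ?R = "four_block_mat (F * R1) R (0\<^sub>m 0 t) (0\<^sub>m 0 r)"
  have "X1 * (Y1 * G) + U * (R * Y) = U * F * G + U * (R * Y)"
    unfolding UF[symmetric] by (simp add: mat_ring)
  also have "\<dots> = U * (R * Y + F * G)"
    by (rule mat_eq_entrywiseI) (simp_all add: mat_ring del: index_mult_mat(1))
  finally have "X1 * (Y1 * G) + U * (R * Y) = U" by (simp add: RY_FG mat_ring)
  then have "?X * ?Y = U @\<^sub>r B"
    by (simp add: mat_ring append_rows_def eqs)
  moreover have "?L * ?X = four_block_mat (1\<^sub>m t) (L1 * (U * R) + - (L1 * (U * R))) (0\<^sub>m r t) (1\<^sub>m r)"
    by (simp add: mat_ring eqs e)
  moreover have "L1 * (U * R) + - (L1 * (U * R)) = 0\<^sub>m t r" by (rule eq_matI) simp_all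
  moreover have "?Y * ?R = 1\<^sub>m (t + r)"
    by (simp add: mat_ring split_simps e)
  ultimately show ?thesis
    unfolding has_rank_def
    by (intro exI[of _ ?X] exI[of _ ?Y] exI[of _ ?L] exI[of _ ?R]) (simp add: append_rows_def)
qed

text \<open>On x = R y + F g the form of the bordered matrix is the one of \<open>F\<^sup>H K F\<close> in g plus the
  hyperbolic form 2 Re y* w, where w collects everything multiplied by y; the latter is
  |y/2 + w|^2 - |y/2 - w|^2.\<close>

lemma has_inertia_bordered:
  assumes K [simp]: "dim_row K = p" "dim_col K = p" "K\<^sup>H = K"
    and "has_inertia (F\<^sup>H * K * F) a b"
  shows "has_inertia (four_block_mat K (B\<^sup>H) B (0\<^sub>m m m)) (a + r) (b + r)"
proof -
  obtain P0 Q0 K0 L0 where d [simp]: "dim_row P0 = f" "dim_col P0 = a" "dim_row Q0 = f"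
      "dim_col Q0 = b" "dim_row K0 = a" "dim_col K0 = f" "dim_row L0 = b" "dim_col L0 = f"
    and FKF: "P0 * P0\<^sup>H - Q0 * Q0\<^sup>H = F\<^sup>H * K * F"
    and e: "K0 * P0 = 1\<^sub>m a" "K0 * Q0 = 0\<^sub>m a b" "L0 * P0 = 0\<^sub>m b a" "L0 * Q0 = 1\<^sub>m b"
    using assms(4) unfolding has_inertia_def by auto
  define h :: complex where "h = 1 / 2"
  have [simp]: "cnj h = h" by (simp add: h_def)
  \<comment> \<open>\<open>V\<close> is the w of the preceding comment. Its \<open>R * Y\<close>
    term is halved because \<open>Y\<^sup>H * V\<close> and its adjoint both contribute it. The
    signs of \<open>X\<close> in \<open>?P\<close> and \<open>?Q\<close> cancel the lower right
    block and double \<open>h \<cdot>\<^sub>m Y\<^sup>H * X\<^sup>H\<close> to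
    \<open>B\<^sup>H\<close>.\<close>
  define V where "V = R\<^sup>H * K * (h \<cdot>\<^sub>m (R * Y) + F * G)"
  have [simp]: "dim_row V = r" "dim_col V = p" by (simp_all add: V_def)
  have VF: "F\<^sup>H * V\<^sup>H = F\<^sup>H * (K * R)"
    by (simp add: V_def mat_ring split_simps)
  let ?P2 = "h \<cdot>\<^sub>m Y\<^sup>H + V\<^sup>H" and ?Q2 = "h \<cdot>\<^sub>m Y\<^sup>H - V\<^sup>H"
  let ?P = "four_block_mat (G\<^sup>H * P0) ?P2 (0\<^sub>m m a) X"
  let ?Q = "four_block_mat (G\<^sup>H * Q0) ?Q2 (0\<^sub>m m b) (- X)"
  have "?P * ?P\<^sup>H - ?Q * ?Q\<^sup>H = four_block_mat
      (G\<^sup>H * (P0 * P0\<^sup>H - Q0 * Q0\<^sup>H) * G + (Y\<^sup>H * V + V\<^sup>H * Y)) (B\<^sup>H) B (0\<^sub>m m m)"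
    by (rule mat_eq_entrywiseI)
      (simp_all add: mat_ring split_simps h_def algebra_simps del: index_mult_mat(1))
  also have "G\<^sup>H * (P0 * P0\<^sup>H - Q0 * Q0\<^sup>H) * G + (Y\<^sup>H * V + V\<^sup>H * Y) = (R * Y + F * G)\<^sup>H * K * (R * Y + F * G)"
    unfolding FKF V_def
    by (rule mat_eq_entrywiseI)
      (simp_all add: mat_ring split_simps h_def algebra_simps del: index_mult_mat(1))
  also have "\<dots> = K"
    by (simp add: RY_FG mat_ring)
  finally have form: "?P * ?P\<^sup>H - ?Q * ?Q\<^sup>H = four_block_mat K (B\<^sup>H) B (0\<^sub>m m m)" .
  \<comment> \<open>The right-hand blocks use \<open>L\<close> to remove the contribution of
    \<open>V\<close>. What \<open>R\<^sup>H\<close> and \<open>L\<close> read off are then two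
    halves, which add up on one of \<open>?P\<close>, \<open>?Q\<close> and cancel on the
    other.\<close>
  let ?K = "four_block_mat (K0 * F\<^sup>H) (- (K0 * (F\<^sup>H * (K * (R * L))))) (R\<^sup>H) (h \<cdot>\<^sub>m L - R\<^sup>H * V\<^sup>H * L)"
  let ?L = "four_block_mat (L0 * F\<^sup>H) (- (L0 * (F\<^sup>H * (K * (R * L))))) (R\<^sup>H) (- (h \<cdot>\<^sub>m L) - R\<^sup>H * V\<^sup>H * L)"
  have "?K * ?P = 1\<^sub>m (a + r)"
    by (rule mat_eq_entrywiseI)
      (simp_all add: mat_ring split_simps e VF h_def algebra_simps del: index_mult_mat(1), arith?)
  moreover have "?K * ?Q = 0\<^sub>m (a + r) (b + r)"
    by (rule mat_eq_entrywiseI)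
      (simp_all add: mat_ring split_simps e VF h_def algebra_simps del: index_mult_mat(1))
  moreover have "?L * ?P = 0\<^sub>m (b + r) (a + r)"
    by (rule mat_eq_entrywiseI)
      (simp_all add: mat_ring split_simps e VF h_def algebra_simps del: index_mult_mat(1))
  moreover have "?L * ?Q = 1\<^sub>m (b + r)"
    by (rule mat_eq_entrywiseI)
      (simp_all add: mat_ring split_simps e VF h_def algebra_simps del: index_mult_mat(1), arith?)
  moreover note form
  ultimately show ?thesis
    unfolding has_inertia_def
    by (intro exI[of _ ?P] exI[of _ ?Q] exI[of _ ?K] exI[of _ ?L]) simp
qed

end

text \<open>\<open>E\<close> projects onto the kernel of \<open>Y\<close> along the range of
  \<open>R\<close>, and any full rank factorization of \<open>E\<close> supplies \<open>F\<close>
  and \<open>G\<close>; idempotence yields \<open>G * F = 1\<^sub>m f\<close>. The factorization of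
  \<open>B\<close> is an input so that special factors can be prescribed.\<close>

lemma rank_split_extend:
  fixes B X Y L R :: "complex mat"
  assumes d [simp]: "dim_row B = m" "dim_col B = p" "dim_row X = m" "dim_col X = r"
      "dim_row Y = r" "dim_col Y = p" "dim_row L = r" "dim_col L = m" "dim_row R = p" "dim_col R = r"
    and A: "X * Y = B" and LX: "L * X = 1\<^sub>m r" and YR: "Y * R = 1\<^sub>m r"
  obtains F G f where "rank_split B X Y L R F G m p r f"
proof -
  define E where "E = 1\<^sub>m p - R * Y"
  have [simp]: "dim_row E = p" "dim_col E = p" by (simp_all add: E_def)
  have YE: "Y * E = 0\<^sub>m r p" and ER: "E * R = 0\<^sub>m p r"
    by (rule mat_eq_entrywiseI;
        simp add: E_def mat_ring YR mult_assoc_eq[OF YR] del: index_mult_mat(1))+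
  obtain f F G S T where df [simp]: "dim_row F = p" "dim_col F = f" "dim_row G = f"
      "dim_col G = p" "dim_row S = f" "dim_col S = p" "dim_row T = p" "dim_col T = f"
    and FG: "F * G = E" and SF: "S * F = 1\<^sub>m f" and GT: "G * T = 1\<^sub>m f"
    using has_rank_exists[of E] unfolding has_rank_def by auto
  have F: "F = E * T" and G: "G = S * E"
    unfolding FG[symmetric] by (simp_all add: mat_ring GT mult_assoc_eq[OF SF])
  have YF: "Y * F = 0\<^sub>m r f" unfolding F by (simp add: mult_assoc_eq[OF YE] mat_ring)
  have GR: "G * R = 0\<^sub>m f r" unfolding G by (simp add: ER mat_ring)
  have "E * E = E - R * (Y * E)" by (subst E_def) (simp add: mat_ring)
  then have EE: "E * E = E" by (simp add: YE mat_ring)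
  have "G * F = S * (E * E) * T" unfolding F G by (simp add: mat_ring)
  also have "\<dots> = S * (F * G) * T" unfolding EE FG ..
  also have "\<dots> = 1\<^sub>m f" by (simp add: mat_ring SF GT mult_assoc_eq[OF SF])
  finally have GF: "G * F = 1\<^sub>m f" .
  have "R * Y + F * G = 1\<^sub>m p"
    unfolding FG E_def by (rule mat_eq_entrywiseI) (simp_all del: index_mult_mat(1))
  then have "rank_split B X Y L R F G m p r f"
    by unfold_locales (simp_all add: A LX YR YF GR GF)
  then show ?thesis by (rule that)
qed

lemma rank_split_exists:
  fixes B :: "complex mat"
  assumes "has_rank B r"
  obtains X Y L R F G f where "rank_split B X Y L R F G (dim_row B) (dim_col B) r f"
proof -
  obtain X Y L R where d: "dim_row X = dim_row B" "dim_col X = r" "dim_row Y = r"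
      "dim_col Y = dim_col B" "dim_row L = r" "dim_col L = dim_row B" "dim_row R = dim_col B" "dim_col R = r"
    and e: "X * Y = B" "L * X = 1\<^sub>m r" "Y * R = 1\<^sub>m r"
    using assms unfolding has_rank_def by metis
  show ?thesis using rank_split_extend[OF refl refl d e] that by metis
qed

section \<open>Inertia of Hermitian perturbations\<close>

lemma has_inertia_one: "has_inertia (1\<^sub>m n) n 0"
  unfolding has_inertia_def
  by (intro exI[of _ "1\<^sub>m n"] exI[of _ "0\<^sub>m n 0"] exI[of _ "0\<^sub>m 0 n"]) (auto simp: mat_ring)

text \<open>The sum is the congruence of the block diagonal matrix of \<open>A\<close> and
  \<open>B\<close> by the block row of \<open>S\<close> and \<open>T\<close>, whose left inverse
  stacks \<open>U\<close> over \<open>V\<close>.\<close>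

lemma has_inertia_direct_sum:
  assumes "has_inertia A p q" "has_inertia B p' q'"
    and [simp]: "dim_row S = n" "dim_col S = dim_row A" "dim_row T = n" "dim_col T = dim_row B"
      "dim_row U = dim_row A" "dim_col U = n" "dim_row V = dim_row B" "dim_col V = n"
    and e: "U * S = 1\<^sub>m (dim_row A)" "U * T = 0\<^sub>m (dim_row A) (dim_row B)"
      "V * S = 0\<^sub>m (dim_row B) (dim_row A)" "V * T = 1\<^sub>m (dim_row B)"
  shows "has_inertia (S * A * S\<^sup>H + T * B * T\<^sup>H) (p + p') (q + q')"
proof -
  have [simp]: "dim_col A = dim_row A" "dim_col B = dim_row B"
    using assms(1,2)[THEN has_inertia_herm] by (auto simp: herm_mats_def)
  let ?T = "four_block_mat S T (0\<^sub>m 0 (dim_row A)) (0\<^sub>m 0 (dim_row B))"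
  let ?U = "four_block_mat U (0\<^sub>m (dim_row A) 0) V (0\<^sub>m (dim_row B) 0)"
  have "?U * ?T = 1\<^sub>m (dim_row A + dim_row B)" by (simp add: mat_ring e)
  from has_inertia_congruence[OF has_inertia_block_diag[OF assms(1,2)], of ?U ?T] this
  have "has_inertia (?T * four_block_mat A (0\<^sub>m (dim_row A) (dim_row B)) (0\<^sub>m (dim_row B) (dim_row A)) B * ?T\<^sup>H) (p + p') (q + q')"
    by simp
  also have "?T * four_block_mat A (0\<^sub>m (dim_row A) (dim_row B)) (0\<^sub>m (dim_row B) (dim_row A)) B * ?T\<^sup>H
      = S * A * S\<^sup>H + T * B * T\<^sup>H"
    by (rule mat_eq_entrywiseI) (simp_all add: mat_ring del: index_mult_mat(1))
  finally show ?thesis .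
qed

text \<open>\<open>D\<close> is the signature matrix with diagonal entries 1 and -1. This form makes
  \<open>U\<^sup>H * D * U\<close> an explicit generalized inverse of \<open>A\<close>, as needed
  for block elimination.\<close>

lemma has_inertia_signature_factor:
  assumes "has_inertia A p q"
  obtains V U D where "dim_row V = dim_row A" "dim_col V = p + q" "dim_row U = p + q" "dim_col U = dim_row A"
    "dim_row D = p + q" "dim_col D = p + q" "V * D * V\<^sup>H = A" "U * V = 1\<^sub>m (p + q)" "D * D = 1\<^sub>m (p + q)"
    "D\<^sup>H = D" "has_inertia D p q"
proof -
  obtain P Q K L where d [simp]: "dim_row P = dim_row A" "dim_col P = p" "dim_row Q = dim_row A"
      "dim_col Q = q" "dim_row K = p" "dim_col K = dim_row A" "dim_row L = q" "dim_col L = dim_row A"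
    and A: "P * P\<^sup>H - Q * Q\<^sup>H = A" and e: "K * P = 1\<^sub>m p" "K * Q = 0\<^sub>m p q" "L * P = 0\<^sub>m q p" "L * Q = 1\<^sub>m q"
    using assms unfolding has_inertia_def by blast
  let ?V = "four_block_mat P Q (0\<^sub>m 0 p) (0\<^sub>m 0 q)"
  let ?U = "four_block_mat K (0\<^sub>m p 0) L (0\<^sub>m q 0)"
  let ?D = "four_block_mat (1\<^sub>m p :: complex mat) (0\<^sub>m p q) (0\<^sub>m q p) (- 1\<^sub>m q)"
  have "?V * ?D * ?V\<^sup>H = A"
    unfolding A[symmetric] by (rule mat_eq_entrywiseI) (simp_all add: mat_ring del: index_mult_mat(1))
  moreover have "?U * ?V = 1\<^sub>m (p + q)" by (simp add: mat_ring e)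
  moreover have "- (- 1\<^sub>m q :: complex mat) = 1\<^sub>m q" by (rule eq_matI) simp_all
  then have "?D * ?D = 1\<^sub>m (p + q)"
    by (simp add: mat_ring)
  moreover have "has_inertia ?D p q"
    using has_inertia_block_diag[OF has_inertia_one[of p] has_inertia_uminus[OF has_inertia_one[of q]]] by simp
  ultimately show ?thesis
    by (intro that[of ?V ?U ?D]) simp_all
qed

text \<open>Here \<open>(p, q)\<close> is the inertia of \<open>C\<close> compressed to the kernel
  of \<open>J\<^sup>H\<close>, and \<open>e\<close> is the rank of the coupling that elimination
  leaves behind; neither depends on \<open>W\<close>. The last three claims are the extreme cases of
  the pair \<open>a\<close>, \<open>b\<close>.\<close>

lemma inertia_of_perturbations:
  fixes C J :: "complex mat"
  assumes [simp]: "dim_row C = n" "dim_col C = n" "C\<^sup>H = C" "dim_row J = n" "dim_col J = f"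
  obtains p q e k where "e \<le> k" "has_rank J k"
    "has_rank (four_block_mat C J (0\<^sub>m 0 n) (0\<^sub>m 0 f)) (p + q + e + k)"
    "has_inertia (four_block_mat C J (J\<^sup>H) (0\<^sub>m f f)) (p + k) (q + k)"
    "\<And>W. W \<in> herm_mats f \<Longrightarrow>
       \<exists>a b. a + b + e \<le> k \<and> has_inertia (C - J * W * J\<^sup>H) (p + e + a) (q + e + b)"
    "\<exists>W\<in>herm_mats f. has_inertia (C - J * W * J\<^sup>H) (p + e) (q + e)"
    "\<exists>W\<in>herm_mats f. has_inertia (C - J * W * J\<^sup>H) (p + k) (q + e)"
    "\<exists>W\<in>herm_mats f. has_inertia (C - J * W * J\<^sup>H) (p + e) (q + k)"
proof -
  \<comment> \<open>Splitting \<open>J\<^sup>H\<close> gives a basis adapted to the perturbation: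
    the columns of \<open>Y\<^sup>H\<close> span the range of \<open>J\<close>, and \<open>F\<close>
    spans the kernel of \<open>J\<^sup>H\<close>, on which \<open>J * W * J\<^sup>H\<close>
    vanishes.\<close>
  obtain k where "has_rank (J\<^sup>H) k" using has_rank_exists by blast
  then obtain X Y L R F G g where S: "rank_split (J\<^sup>H) X Y L R F G f n k g"
    using rank_split_exists[of "J\<^sup>H" k] by (metis assms(4,5) dim_adj)
  interpret S: rank_split "J\<^sup>H" X Y L R F G f n k g by (rule S)
  have "F\<^sup>H * C * F \<in> herm_mats g" by (auto simp: herm_mats_def mat_ring intro!: carrier_matI)
  then obtain p q where pq: "has_inertia (F\<^sup>H * C * F) p q" using hermitian_has_inertia by blast
  obtain V U D where d: "dim_row V = dim_row (F\<^sup>H * C * F)" "dim_col V = p + q"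
      "dim_row U = p + q" "dim_col U = dim_row (F\<^sup>H * C * F)"
      "dim_row D = p + q" "dim_col D = p + q" and VDV: "V * D * V\<^sup>H = F\<^sup>H * C * F"
      and UV: "U * V = 1\<^sub>m (p + q)" and DD: "D * D = 1\<^sub>m (p + q)" and DH: "D\<^sup>H = D" and D: "has_inertia D p q"
    using has_inertia_signature_factor[OF pq] by metis
  define s where "s = p + q"
  note d [simp] = d[simplified, unfolded S.dims, folded s_def]
  note UV = UV[folded s_def] and DD = DD[folded s_def]
  have VU: "V\<^sup>H * U\<^sup>H = 1\<^sub>m s" using arg_cong[OF UV, of mat_adjoint] by simp
  \<comment> \<open>The factorization is prescribed, so that the complement \<open>F3\<close>, a
    basis of the kernel of the compression, fits the factors \<open>V\<close>, \<open>D\<close>,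
    \<open>U\<close> used in the elimination.\<close>
  obtain F3 G3 g3 where S2: "rank_split (F\<^sup>H * C * F) (V * D) (V\<^sup>H) (D * U) (U\<^sup>H) F3 G3 g g s g3"
    by (rule rank_split_extend[of "F\<^sup>H * C * F" g g "V * D" s "V\<^sup>H" "D * U" "U\<^sup>H"])
      (simp_all add: s_def[symmetric] VDV VU mat_ring mult_assoc_eq[OF UV] DD)
  interpret S2: rank_split "F\<^sup>H * C * F" "V * D" "V\<^sup>H" "D * U" "U\<^sup>H" F3 G3 g g s g3 by (rule S2)
  \<comment> \<open>The coupling between the range of \<open>J\<close> and the kernel of the
    compression. The adjoint is split below because the free part of the perturbation lives on the
    kernel of \<open>E\<^sup>H\<close>, of dimension \<open>k - e\<close>.\<close>
  define E where "E = R\<^sup>H * C * F * F3"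
  have [simp]: "dim_row E = k" "dim_col E = g3" by (simp_all add: E_def)
  obtain e where e: "has_rank (E\<^sup>H) e" using has_rank_exists by blast
  then obtain X5 Y5 L5 R5 F5 G5 f5 where S3: "rank_split (E\<^sup>H) X5 Y5 L5 R5 F5 G5 g3 k e f5"
    using rank_split_exists[of "E\<^sup>H" e] by (metis \<open>dim_row E = k\<close> \<open>dim_col E = g3\<close> dim_adj)
  interpret S3: rank_split "E\<^sup>H" X5 Y5 L5 R5 F5 G5 g3 k e f5 by (rule S3)
  have ek: "e + f5 = k" by (rule S3.dim_sum)

  have 1: "has_rank J k" using has_rank_adj[OF S.rank(1)] by simp
  have 2: "has_inertia (four_block_mat C J (J\<^sup>H) (0\<^sub>m f f)) (p + k) (q + k)"
    using S.has_inertia_bordered[OF _ _ _ pq] by simp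
  \<comment> \<open>The rank of \<open>C * F\<close> is computed from its \<open>R\<close> and
    \<open>F\<close> components. Stacking \<open>R\<^sup>H\<close> over \<open>F\<^sup>H\<close>
    gives an invertible matrix whose inverse is the block row of \<open>Y\<^sup>H\<close> and
    \<open>G\<^sup>H\<close>.\<close>
  have "has_rank E e" using has_rank_adj[OF e] by simp
  then have "has_rank (R\<^sup>H * C * F @\<^sub>r F\<^sup>H * C * F) (e + s)"
    by (intro S2.has_rank_append) (simp_all add: E_def)
  moreover have "four_block_mat (Y\<^sup>H) (G\<^sup>H) (0\<^sub>m 0 k) (0\<^sub>m 0 g) * (R\<^sup>H * C * F @\<^sub>r F\<^sup>H * C * F) * 1\<^sub>m g
      = (R * Y + F * G)\<^sup>H * (C * F)"
    by (rule mat_eq_entrywiseI) (simp_all add: append_rows_def mat_ring del: index_mult_mat(1))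
  then have "four_block_mat (Y\<^sup>H) (G\<^sup>H) (0\<^sub>m 0 k) (0\<^sub>m 0 g) * (R\<^sup>H * C * F @\<^sub>r F\<^sup>H * C * F) * 1\<^sub>m g = C * F"
    by (simp add: S.RY_FG one_mult_mat del: adj_add adj_mult)
  moreover have "four_block_mat (R\<^sup>H) (0\<^sub>m k 0) (F\<^sup>H) (0\<^sub>m g 0) * four_block_mat (Y\<^sup>H) (G\<^sup>H) (0\<^sub>m 0 k) (0\<^sub>m 0 g) = 1\<^sub>m (k + g)"
    by (simp add: mat_ring S.eqs)
  ultimately have "has_rank (C * F) (e + s)"
    using has_rank_equiv[of "R\<^sup>H * C * F @\<^sub>r F\<^sup>H * C * F" "e + s"
        "four_block_mat (R\<^sup>H) (0\<^sub>m k 0) (F\<^sup>H) (0\<^sub>m g 0)" "four_block_mat (Y\<^sup>H) (G\<^sup>H) (0\<^sub>m 0 k) (0\<^sub>m 0 g)" "1\<^sub>m g" "1\<^sub>m g"]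
    by (simp add: append_rows_def one_mult_mat)
  \<comment> \<open>Stacking \<open>J\<^sup>H\<close> below adds its rank \<open>k\<close>; the
    adjoint of the result is the block row of \<open>C\<close> and \<open>J\<close>.\<close>
  then have "has_rank (C @\<^sub>r J\<^sup>H) (e + s + k)" by (intro S.has_rank_append) simp_all
  then have 3: "has_rank (four_block_mat C J (0\<^sub>m 0 n) (0\<^sub>m 0 f)) (p + q + e + k)"
    using has_rank_adj by (force simp: append_rows_def s_def add_ac)

  \<comment> \<open>The generalized Schur complement of the compression, with
    \<open>U\<^sup>H * D * U\<close> as generalized inverse.\<close>
  define Z where "Z = R\<^sup>H * C * R - R\<^sup>H * C * F * U\<^sup>H * D * U * F\<^sup>H * C * R"
  have [simp]: "dim_row Z = k" "dim_col Z = k" by (simp_all add: Z_def)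
  have ZH: "Z\<^sup>H = Z" by (simp add: Z_def mat_ring DH)
  \<comment> \<open>These rules eliminate \<open>F3 * G3\<close> in favour of \<open>U\<close> and
    \<open>V\<close>, so that the terms of the congruence below cancel syntactically.\<close>
  have FG3: "F3 * (G3 * M) = M - U\<^sup>H * (V\<^sup>H * M)" "G3\<^sup>H * (F3\<^sup>H * M) = M - V * (U * M)" if [simp]: "dim_row M = g" for M
  proof -
    have F3G3: "F3 * G3 = 1\<^sub>m g - U\<^sup>H * V\<^sup>H"
      using S2.RY_FG by (intro mat_eq_entrywiseI) (auto simp: mat_eq_iff eq_diff_eq add.commute simp del: index_mult_mat(1))
    have "G3\<^sup>H * F3\<^sup>H = 1\<^sub>m g - V * U"
      using arg_cong[OF F3G3, of mat_adjoint] by simp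
    with F3G3 have "F3 * G3 * M = (1\<^sub>m g - U\<^sup>H * V\<^sup>H) * M" "G3\<^sup>H * F3\<^sup>H * M = (1\<^sub>m g - V * U) * M" by simp_all
    then show "F3 * (G3 * M) = M - U\<^sup>H * (V\<^sup>H * M)" "G3\<^sup>H * (F3\<^sup>H * M) = M - V * (U * M)"
      by (simp_all add: mat_ring)
  qed
  have VDV': "V * (D * (V\<^sup>H * M)) = F\<^sup>H * (C * (F * M))" if [simp]: "dim_row M = g" for M
    using arg_cong[OF VDV, of "\<lambda>N. N * M"] by (simp add: mat_ring)
  have S2_0: "F3\<^sup>H * V = 0\<^sub>m g3 s" "U * G3\<^sup>H = 0\<^sub>m s g3"
    using S2.adj_eqs by simp_all
  note S2_simps = S2_0 S2_0[THEN mult_assoc_eq] S2.GF S2.adj_eqs(6)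
  have key: "has_inertia (C - Y\<^sup>H * H * Y) (p + e + a) (q + e + b)"
    if H [simp]: "dim_row H = k" "dim_col H = k" "H\<^sup>H = H" and ab: "has_inertia (F5\<^sup>H * (Z - H) * F5) a b" for H a b
  proof -
    let ?B = "four_block_mat (Z - H) E (E\<^sup>H) (0\<^sub>m g3 g3)"
    have B: "has_inertia (four_block_mat (Z - H) E (E\<^sup>H) (0\<^sub>m g3 g3)) (a + e) (b + e)"
      using S3.has_inertia_bordered[of "Z - H" a b] ab by (simp add: ZH)
    \<comment> \<open>Completing the square: \<open>T1 * D * T1\<^sup>H\<close> produces the
      compression of \<open>C\<close> and the part of the coupling it can absorb. The remainder,
      spread by \<open>T2\<close>, is \<open>Z - H\<close> bordered by \<open>E\<close>;
      \<open>U1\<close> and \<open>U2\<close> invert this change of basis.\<close>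
    define T1 where "T1 = G\<^sup>H * V + Y\<^sup>H * (R\<^sup>H * (C * (F * (U\<^sup>H * D))))"
    define T2 where "T2 = four_block_mat (Y\<^sup>H) (G\<^sup>H * G3\<^sup>H) (0\<^sub>m 0 k) (0\<^sub>m 0 g3)"
    define U1 where "U1 = U * F\<^sup>H"
    define U2 where "U2 = four_block_mat (R\<^sup>H - R\<^sup>H * (C * (F * (U\<^sup>H * (D * (U * F\<^sup>H)))))) (0\<^sub>m k 0) (F3\<^sup>H * F\<^sup>H) (0\<^sub>m g3 0)"
    have [simp]: "dim_row T1 = n" "dim_col T1 = s" "dim_row T2 = n" "dim_col T2 = k + g3"
      "dim_row U1 = s" "dim_col U1 = n" "dim_row U2 = k + g3" "dim_col U2 = n"
      by (simp_all add: T1_def T2_def U1_def U2_def)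
    have 1: "U1 * T1 = 1\<^sub>m s" "U1 * T2 = 0\<^sub>m s (k + g3)"
      by (simp_all add: U1_def T1_def T2_def mult_row_block mat_ring S.split_simps UV S2_simps)
    have 2: "U2 * T1 = 0\<^sub>m (k + g3) s" "U2 * T2 = 1\<^sub>m (k + g3)"
      by (rule mat_eq_entrywiseI;
          simp add: U2_def T1_def T2_def mult_col_block mat_ring S.split_simps UV S2_simps del: index_mult_mat(1))+
    have "T1 * D * T1\<^sup>H + T2 * ?B * T2\<^sup>H = (R * Y + F * G)\<^sup>H * C * (R * Y + F * G) - Y\<^sup>H * H * Y"
      by (rule mat_eq_entrywiseI)
        (simp_all add: T1_def T2_def Z_def E_def mat_ring DH mult_assoc_eq[OF DD] FG3 VDV' algebra_simps
          del: index_mult_mat(1))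
    also have "\<dots> = C - Y\<^sup>H * H * Y" by (simp add: S.RY_FG mat_ring del: adj_add)
    finally show ?thesis
      using has_inertia_direct_sum[OF D B, of T1 n T2 U1 U2] 1 2 by (simp add: add_ac)
  qed
  \<comment> \<open>Since \<open>L * J\<^sup>H = Y\<close>, every Hermitian \<open>H\<close> on the
    range of \<open>J\<close> comes from some \<open>W\<close>.\<close>
  have W: "L\<^sup>H * H * L \<in> herm_mats f" "C - J * (L\<^sup>H * H * L) * J\<^sup>H = C - Y\<^sup>H * H * Y"
    if [simp]: "dim_row H = k" "dim_col H = k" "H\<^sup>H = H" for H
  proof -
    have "L\<^sup>H * H * L \<in> carrier_mat f f" by (rule carrier_matI) simp_all
    then show "L\<^sup>H * H * L \<in> herm_mats f" by (simp add: herm_mats_def mat_ring)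
    have "J * L\<^sup>H = Y\<^sup>H * (X\<^sup>H * L\<^sup>H)" "L * J\<^sup>H = L * X * Y"
      using S.adj_eqs(1) S.XY by (simp_all flip: mult_assoc_mat) (simp add: mult_assoc_mat)
    then have JL: "J * L\<^sup>H = Y\<^sup>H" "L * J\<^sup>H = Y" by (simp_all add: S.eqs mat_ring)
    show "C - J * (L\<^sup>H * H * L) * J\<^sup>H = C - Y\<^sup>H * H * Y"
      by (simp add: mat_ring JL mult_assoc_eq[OF JL(1)])
  qed
  \<comment> \<open>With \<open>H = Z - N\<close> the free block becomes \<open>N\<close>, so any
    prescribed Hermitian \<open>N\<close> can be reached.\<close>
  have wit: "\<exists>W\<in>herm_mats f. has_inertia (C - J * W * J\<^sup>H) (p + e + a) (q + e + b)"
    if N: "dim_row N = k" "dim_col N = k" "N\<^sup>H = N" "has_inertia (F5\<^sup>H * N * F5) a b" for N a b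
  proof -
    have "Z - (Z - N) = N" using N by (intro eq_matI) simp_all
    then have "has_inertia (C - Y\<^sup>H * (Z - N) * Y) (p + e + a) (q + e + b)"
      using N by (intro key) (simp_all add: ZH)
    then show ?thesis using W[of "Z - N"] N by (metis ZH \<open>dim_row Z = k\<close> \<open>dim_col Z = k\<close> adj_diff index_minus_mat(2,3))
  qed
  show ?thesis
  proof (rule that[OF _ 1 3 2])
    show "e \<le> k" using ek by simp
    show "\<exists>a b. a + b + e \<le> k \<and> has_inertia (C - J * W * J\<^sup>H) (p + e + a) (q + e + b)" if "W \<in> herm_mats f" for W
    proof -
      have [simp]: "dim_row W = f" "dim_col W = f" "W\<^sup>H = W" using that by (auto simp: herm_mats_def)
      let ?H = "X\<^sup>H * W * X"
      have "(Y\<^sup>H * X\<^sup>H) * W * (X * Y) = J * W * J\<^sup>H" by (simp only: S.eqs) simp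
      then have JWJ: "J * W * J\<^sup>H = Y\<^sup>H * ?H * Y" by (simp add: mat_ring)
      have "F5\<^sup>H * (Z - ?H) * F5 \<in> carrier_mat f5 f5" by (rule carrier_matI) simp_all
      then have "F5\<^sup>H * (Z - ?H) * F5 \<in> herm_mats f5"
        by (simp add: herm_mats_def ZH mat_ring)
      then obtain a b where ab: "has_inertia (F5\<^sup>H * (Z - ?H) * F5) a b" using hermitian_has_inertia by blast
      \<comment> \<open>The compression has size \<open>f5\<close>, which is
        \<open>k - e\<close>.\<close>
      have "a + b \<le> f5" using sylvester_inertia(3)[OF ab] mrank_le_dim_col[of "F5\<^sup>H * (Z - ?H) * F5"] by simp
      then have "a + b + e \<le> k" using ek by simp
      moreover have "has_inertia (C - J * W * J\<^sup>H) (p + e + a) (q + e + b)"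
        unfolding JWJ by (rule key[OF _ _ _ ab]) (simp_all add: mat_ring)
      ultimately show ?thesis by blast
    qed
    \<comment> \<open>Because \<open>G5 * F5\<close> is the identity, the choices 0,
      \<open>G5\<^sup>H * G5\<close> and its negative compress to zero, the identity and minus the
      identity of size \<open>k - e\<close>.\<close>
    show "\<exists>W\<in>herm_mats f. has_inertia (C - J * W * J\<^sup>H) (p + e) (q + e)"
      using wit[of "0\<^sub>m k k" 0 0] has_inertia_zero[of f5] by (simp add: mat_ring)
    show "\<exists>W\<in>herm_mats f. has_inertia (C - J * W * J\<^sup>H) (p + k) (q + e)"
      using wit[of "G5\<^sup>H * G5" f5 0] has_inertia_one[of f5] ek by (simp add: mat_ring S3.split_simps add.assoc)
    show "\<exists>W\<in>herm_mats f. has_inertia (C - J * W * J\<^sup>H) (p + e) (q + k)"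
      using wit[of "- (G5\<^sup>H * G5)" 0 f5] has_inertia_uminus[OF has_inertia_one[of f5]] ek
      by (simp add: mat_ring S3.split_simps add.assoc)
  qed
qed

section \<open>Definiteness and range inclusion\<close>

lemma has_inertia_dim_col: "has_inertia A p q \<Longrightarrow> dim_col A = dim_row A"
  using has_inertia_herm by (metis (no_types, lifting) carrier_matD(2) herm_mats_def mem_Collect_eq)

lemma has_inertia_dim_le:
  assumes "has_inertia A p q"
  shows "p + q \<le> dim_row A"
  using mrank_le_dim_col[of A] sylvester_inertia(3)[OF assms] has_inertia_dim_col[OF assms] by simp

lemma has_inertia_zero_iff:
  assumes "has_inertia A p q"
  shows "A = 0\<^sub>m (dim_row A) (dim_row A) \<longleftrightarrow> p + q = 0"
proof
  assume "A = 0\<^sub>m (dim_row A) (dim_row A)"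
  then have "has_inertia A 0 0" using has_inertia_zero[of "dim_row A"] by simp
  then show "p + q = 0"
    using sylvester_inertia(3)[OF assms] sylvester_inertia(3)[of A 0 0] by simp
next
  assume 0: "p + q = 0"
  obtain P Q where d: "dim_row P = dim_row A" "dim_col P = p" "dim_row Q = dim_row A"
      "dim_col Q = q" and A: "P * P\<^sup>H - Q * Q\<^sup>H = A"
    using assms unfolding has_inertia_def by metis
  have "P * P\<^sup>H - Q * Q\<^sup>H = 0\<^sub>m (dim_row A) (dim_row A)"
    using 0 d by (intro mat_eq_entrywiseI) (simp_all add: scalar_prod_def)
  then show "A = 0\<^sub>m (dim_row A) (dim_row A)" by (simp only: A)
qed

lemma invertible_iff_mrank:
  fixes A :: "complex mat"
  assumes A: "A \<in> carrier_mat n n"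
  shows "invertible_mat A \<longleftrightarrow> mrank A = n"
proof -
  have "invertible_mat A \<longleftrightarrow> det A \<noteq> 0"
  proof
    assume "invertible_mat A"
    then obtain B where B: "A * B = 1\<^sub>m n" "B * A = 1\<^sub>m (dim_row B)"
      using A unfolding invertible_mat_def inverts_mat_def by (metis carrier_matD(1))
    then have "dim_row B = n" "dim_col B = n"
      using A by (metis carrier_matD(2) index_mult_mat(3) index_one_mat(3))+
    then have "B \<in> carrier_mat n n" by (rule carrier_matI)
    from det_mult[OF A this] have "det A * det B = 1" by (simp add: B(1))
    then show "det A \<noteq> 0" by auto
  next
    assume "det A \<noteq> 0"
    from det_non_zero_imp_unit[OF A this, unfolded Units_def, of "()"]
    obtain B where "B \<in> carrier_mat n n" "B * A = 1\<^sub>m n" "A * B = 1\<^sub>m n"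
      by (auto simp: ring_mat_def)
    then show "invertible_mat A"
      using A by (auto simp: invertible_mat_def inverts_mat_def intro!: exI[of _ B])
  qed
  then show ?thesis using mrank_det[OF A] by simp
qed

lemma pos_semidef_iff_inertia:
  assumes "has_inertia A p q"
  shows "pos_semidef A \<longleftrightarrow> q = 0"
proof
  obtain P Q K L where d [simp]: "dim_row P = dim_row A" "dim_col P = p" "dim_row Q = dim_row A"
      "dim_col Q = q" "dim_row K = p" "dim_col K = dim_row A" "dim_row L = q" "dim_col L = dim_row A"
    and A: "P * P\<^sup>H - Q * Q\<^sup>H = A" and e: "K * P = 1\<^sub>m p" "K * Q = 0\<^sub>m p q" "L * P = 0\<^sub>m q p" "L * Q = 1\<^sub>m q"
    using assms unfolding has_inertia_def by blast
  have [simp]: "dim_col A = dim_row A" using has_inertia_dim_col[OF assms] .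
  {
    assume "q = 0"
    then have "Q * Q\<^sup>H = 0\<^sub>m (dim_row A) (dim_row A)" by (intro eq_matI) (simp_all add: scalar_prod_def)
    then have PP: "P * P\<^sup>H = A" using A by (simp add: mat_ring)
    have "0 \<le> (A *\<^sub>v v) \<bullet>c v" if "v \<in> carrier_vec (dim_row A)" for v
      using gram_form[of v P] conjugate_square_ge_0_vec[of "P\<^sup>H *\<^sub>v v"] that by (simp add: PP)
    then show "pos_semidef A" unfolding pos_semidef_def using has_inertia_herm[OF assms] by simp
  }
  assume psd: "pos_semidef A"
  show "q = 0"
  proof (rule ccontr)
    assume q: "q \<noteq> 0"
    have "L * (A * L\<^sup>H) = (L * P) * (L * P)\<^sup>H - (L * Q) * (L * Q)\<^sup>H"
      unfolding A[symmetric] by (simp add: mat_ring)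
    also have "\<dots> = - 1\<^sub>m q" unfolding e by (rule mat_eq_entrywiseI) (simp_all add: mat_ring)
    finally have LAL: "L * (A * L\<^sup>H) = - 1\<^sub>m q" .
    \<comment> \<open>\<open>L * A * L\<^sup>H\<close> is minus the identity, so the image of a unit
      vector under \<open>L\<^sup>H\<close> has form value -1.\<close>
    let ?e = "unit_vec q 0 :: complex vec" and ?v = "L\<^sup>H *\<^sub>v unit_vec q 0"
    have [simp]: "?v \<in> carrier_vec (dim_row A)" "A *\<^sub>v ?v \<in> carrier_vec (dim_row A)" by (auto intro: carrier_vecI)
    have "L * (A * L\<^sup>H) *\<^sub>v ?e = L *\<^sub>v (A *\<^sub>v ?v)"
      by (simp add: mult_mat_vec_assoc)
    then have "(A *\<^sub>v ?v) \<bullet>c ?v = (- 1\<^sub>m q *\<^sub>v ?e) \<bullet>c ?e"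
      using inner_adj[of "A *\<^sub>v ?v" L ?e] by (simp add: LAL)
    also have "\<dots> = -1" using q by simp
    finally have "(A *\<^sub>v ?v) \<bullet>c ?v = -1" .
    moreover have "0 \<le> (A *\<^sub>v ?v) \<bullet>c ?v" using psd unfolding pos_semidef_def by simp
    ultimately show False by (simp add: less_eq_complex_def)
  qed
qed

text \<open>Positive definite means positive semi-definite and nonsingular. Conversely
  \<open>p = dim_row A\<close> leaves no room for \<open>q\<close>, and a nonsingular
  \<open>P * P\<^sup>H\<close> has \<open>P\<^sup>H\<close> injective.\<close>

lemma pos_def_iff_inertia:
  assumes "has_inertia A p q"
  shows "pos_def A \<longleftrightarrow> p = dim_row A"
proof -
  let ?n = "dim_row A"
  have herm: "A \<in> herm_mats ?n" using has_inertia_herm[OF assms] .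
  then have A: "A \<in> carrier_mat ?n ?n" by (simp add: herm_mats_def)
  have full: "det A \<noteq> 0 \<longleftrightarrow> p + q = ?n" using mrank_det[OF A] sylvester_inertia(3)[OF assms] by simp
  have ker: "det A = 0 \<longleftrightarrow> (\<exists>v. v \<in> carrier_vec ?n \<and> v \<noteq> 0\<^sub>v ?n \<and> A *\<^sub>v v = 0\<^sub>v ?n)"
    by (rule det_0_iff_vec_prod_zero_field[OF A])
  show ?thesis
  proof
    assume pd: "pos_def A"
    have "0 \<le> (A *\<^sub>v v) \<bullet>c v" if "v \<in> carrier_vec ?n" for v
    proof (cases "v = 0\<^sub>v ?n")
      case True
      then show ?thesis by (simp add: scalar_prod_def)
    next
      case False
      then show ?thesis using pd that unfolding pos_def_def by (blast intro: less_imp_le)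
    qed
    then have "q = 0" using pos_semidef_iff_inertia[OF assms] herm by (simp add: pos_semidef_def)
    moreover have "det A \<noteq> 0" using pd unfolding ker pos_def_def by (auto dest!: bspec)
    ultimately show "p = ?n" using full by simp
  next
    assume p: "p = ?n"
    then have q: "q = 0" using has_inertia_dim_le[OF assms] by simp
    obtain P Q where d [simp]: "dim_row P = ?n" "dim_col P = p" "dim_row Q = ?n"
        "dim_col Q = q" and PQ: "P * P\<^sup>H - Q * Q\<^sup>H = A"
      using assms unfolding has_inertia_def by metis
    have "Q * Q\<^sup>H = 0\<^sub>m ?n ?n" using q by (intro eq_matI) (simp_all add: scalar_prod_def)
    then have PP: "P * P\<^sup>H = A" using PQ by (simp add: mat_ring)
    have "0 < (A *\<^sub>v v) \<bullet>c v" if v: "v \<in> carrier_vec ?n" "v \<noteq> 0\<^sub>v ?n" for v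
    proof -
      have Pv: "P\<^sup>H *\<^sub>v v \<in> carrier_vec p" by (rule carrier_vecI) simp
      have "A *\<^sub>v v = P *\<^sub>v (P\<^sup>H *\<^sub>v v)"
        unfolding PP[symmetric] using v(1) by (simp add: mult_mat_vec_assoc)
      moreover have "P *\<^sub>v 0\<^sub>v p = 0\<^sub>v ?n" by (rule eq_vecI) (simp_all add: scalar_prod_def)
      ultimately have "P\<^sup>H *\<^sub>v v \<noteq> 0\<^sub>v p" using ker full v p q by auto
      then show ?thesis using gram_form[of v P] v(1) Pv by (simp add: PP)
    qed
    then show "pos_def A" using herm by (simp add: pos_def_def)
  qed
qed

text \<open>The negative cases reduce to the positive ones for \<open>- A\<close>, whose inertia is
  the swapped pair.\<close>

lemma uminus_form:
  fixes A :: "complex mat"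
  assumes "A \<in> carrier_mat n n" "v \<in> carrier_vec n"
  shows "(- A *\<^sub>v v) \<bullet>c v = - ((A *\<^sub>v v) \<bullet>c v)"
  using assms by (simp add: scalar_prod_def sum_negf)

lemma herm_uminus: "A \<in> herm_mats n \<Longrightarrow> - A \<in> herm_mats n"
  by (auto simp: herm_mats_def)

lemma neg_semidef_iff_inertia:
  assumes "has_inertia A p q"
  shows "neg_semidef A \<longleftrightarrow> p = 0"
proof -
  have herm: "A \<in> herm_mats (dim_row A)" by (rule has_inertia_herm[OF assms])
  have "(- A *\<^sub>v v) \<bullet>c v = - ((A *\<^sub>v v) \<bullet>c v)" if "v \<in> carrier_vec (dim_row A)" for v
    using uminus_form[OF _ that] herm unfolding herm_mats_def by blast
  then have "neg_semidef A \<longleftrightarrow> pos_semidef (- A)"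
    using herm herm_uminus[OF herm] by (simp add: neg_semidef_def pos_semidef_def)
  then show ?thesis using pos_semidef_iff_inertia[OF has_inertia_uminus[OF assms]] by simp
qed

lemma neg_def_iff_inertia:
  assumes "has_inertia A p q"
  shows "neg_def A \<longleftrightarrow> q = dim_row A"
proof -
  have herm: "A \<in> herm_mats (dim_row A)" by (rule has_inertia_herm[OF assms])
  have "(- A *\<^sub>v v) \<bullet>c v = - ((A *\<^sub>v v) \<bullet>c v)" if "v \<in> carrier_vec (dim_row A)" for v
    using uminus_form[OF _ that] herm unfolding herm_mats_def by blast
  then have "neg_def A \<longleftrightarrow> pos_def (- A)"
    using herm herm_uminus[OF herm] by (simp add: neg_def_def pos_def_def)
  then show ?thesis using pos_def_iff_inertia[OF has_inertia_uminus[OF assms]] by simp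
qed

text \<open>Preimages of the single columns of \<open>A\<close> are collected as the columns of
  \<open>Z\<close>.\<close>

lemma mrange_subset_iff:
  assumes "dim_row A = dim_row B"
  shows "mrange A \<subseteq> mrange B \<longleftrightarrow> (\<exists>Z. dim_row Z = dim_col B \<and> dim_col Z = dim_col A \<and> B * Z = A)"
proof
  assume sub: "mrange A \<subseteq> mrange B"
  have "\<exists>x. x \<in> carrier_vec (dim_col B) \<and> B *\<^sub>v x = col A j" if j: "j < dim_col A" for j
  proof -
    have "col A j \<in> mrange A"
      using j by (auto simp: vec_space.col_space_eq[of A "dim_row A" "dim_col A"]
          intro!: bexI[of _ "unit_vec (dim_col A) j"] eq_vecI)
    then have "col A j \<in> mrange B" using sub by blast
    then show ?thesis
      by (auto simp: vec_space.col_space_eq[of B "dim_row B" "dim_col B"])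
  qed
  then obtain x where x: "\<And>j. j < dim_col A \<Longrightarrow> x j \<in> carrier_vec (dim_col B) \<and> B *\<^sub>v x j = col A j"
    by metis
  define Z where "Z = mat (dim_col B) (dim_col A) (\<lambda>(i, j). x j $ i)"
  have [simp]: "dim_row Z = dim_col B" "dim_col Z = dim_col A" by (simp_all add: Z_def)
  have colZ: "col Z j = x j" if "j < dim_col A" for j
    using x[OF that] that by (intro eq_vecI) (auto simp: Z_def)
  have "B * Z = A"
  proof (rule mat_eq_entrywiseI)
    fix i j assume i: "i < dim_row (B * Z)" and "j < dim_col (B * Z)"
    then have j: "j < dim_col A" by simp
    have "(B * Z) $$ (i, j) = (B *\<^sub>v x j) $ i" using i j by (simp add: colZ)
    then show "(B * Z) $$ (i, j) = A $$ (i, j)" using x[OF j] i j assms by simp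
  qed (simp_all add: Z_def assms)
  then show "\<exists>Z. dim_row Z = dim_col B \<and> dim_col Z = dim_col A \<and> B * Z = A"
    by (intro exI[of _ Z]) (simp add: Z_def)
next
  assume "\<exists>Z. dim_row Z = dim_col B \<and> dim_col Z = dim_col A \<and> B * Z = A"
  then show "mrange A \<subseteq> mrange B" using mrange_mult_subset[of B] assms by metis
qed

section \<open>Hermitian solutions and the block matrices M and N\<close>

text \<open>In both block matrices \<open>B4\<close> enters through the block row [0, B4]. Its
  kernel contains all of the first \<open>l\<close> coordinates, so \<open>F\<close> and
  \<open>G\<close> are enlarged by an identity block.\<close>

lemma rank_split_pad:
  assumes "rank_split B X Y L R F G m n r g"
  shows "rank_split (four_block_mat (0\<^sub>m m l) B (0\<^sub>m 0 l) (0\<^sub>m 0 n)) X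
    (four_block_mat (0\<^sub>m r l) Y (0\<^sub>m 0 l) (0\<^sub>m 0 n)) L (four_block_mat (0\<^sub>m l r) (0\<^sub>m l 0) R (0\<^sub>m n 0))
    (four_block_mat (1\<^sub>m l) (0\<^sub>m l g) (0\<^sub>m n l) F) (four_block_mat (1\<^sub>m l) (0\<^sub>m l n) (0\<^sub>m g l) G)
    m (l + n) r (l + g)"
proof -
  interpret rank_split B X Y L R F G m n r g by (rule assms)
  have "R * Y + F * G = 1\<^sub>m n" by (rule RY_FG)
  then have *: "(R * Y) $$ (i, j) + (F * G) $$ (i, j) = (if i = j then 1 else 0)" if "i < n" "j < n" for i j
    using that by (auto simp: mat_eq_iff simp del: index_mult_mat(1))
  show ?thesis
  proof unfold_locales
    show "X * four_block_mat (0\<^sub>m r l) Y (0\<^sub>m 0 l) (0\<^sub>m 0 n) = four_block_mat (0\<^sub>m m l) B (0\<^sub>m 0 l) (0\<^sub>m 0 n)"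
      by (simp add: mult_row_block mat_ring eqs)
  qed (auto intro!: mat_eq_entrywiseI simp: mat_ring eqs * simp del: index_mult_mat(1))
qed

context
  fixes A1 B1 A4 B4 X0 X Y L R F G :: "complex mat" and m1 n m r g :: nat
  assumes split: "rank_split B4 X Y L R F G m n r g"
    and d [simp]: "dim_row A1 = m1" "dim_col A1 = m1" "dim_row B1 = m1" "dim_col B1 = n"
      "dim_row X0 = n" "dim_col X0 = n"
    and herm: "A1\<^sup>H = A1" "X0\<^sup>H = X0"
    and sol: "B4 * X0 = A4"
begin

interpretation rank_split B4 X Y L R F G m n r g by (rule split)

interpretation pad: rank_split "four_block_mat (0\<^sub>m m m1) B4 (0\<^sub>m 0 m1) (0\<^sub>m 0 n)" X
    "four_block_mat (0\<^sub>m r m1) Y (0\<^sub>m 0 m1) (0\<^sub>m 0 n)" L "four_block_mat (0\<^sub>m m1 r) (0\<^sub>m m1 0) R (0\<^sub>m n 0)"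
    "four_block_mat (1\<^sub>m m1) (0\<^sub>m m1 g) (0\<^sub>m n m1) F" "four_block_mat (1\<^sub>m m1) (0\<^sub>m m1 n) (0\<^sub>m g m1) G"
    m "m1 + n" r "m1 + g"
  by (rule rank_split_pad[OF split])

text \<open>As \<open>A4 = B4 * X0\<close>, adding the second block column times
  \<open>X0 * B1\<^sup>H\<close> to the first turns [C, B1; 0, B4] into the matrix M. Here C is
  \<open>A1 - B1 * X0 * B1\<^sup>H\<close>.\<close>

lemma has_rank_block_M:
  assumes "has_rank (four_block_mat (A1 - B1 * X0 * B1\<^sup>H) (B1 * F) (0\<^sub>m 0 m1) (0\<^sub>m 0 g)) t"
  shows "has_rank (block_M A1 B1 A4 B4) (t + r)"
proof -
  let ?U = "four_block_mat (A1 - B1 * X0 * B1\<^sup>H) B1 (0\<^sub>m 0 m1) (0\<^sub>m 0 n)"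
  let ?M = "four_block_mat (A1 - B1 * X0 * B1\<^sup>H) B1 (0\<^sub>m m m1) B4"
  let ?T = "four_block_mat (1\<^sub>m m1) (0\<^sub>m m1 n) (X0 * B1\<^sup>H) (1\<^sub>m n)"
  let ?T' = "four_block_mat (1\<^sub>m m1) (0\<^sub>m m1 n) (- (X0 * B1\<^sup>H)) (1\<^sub>m n)"
  have "?U * four_block_mat (1\<^sub>m m1) (0\<^sub>m m1 g) (0\<^sub>m n m1) F
      = four_block_mat (A1 - B1 * X0 * B1\<^sup>H) (B1 * F) (0\<^sub>m 0 m1) (0\<^sub>m 0 g)"
    by (simp add: mat_ring)
  with pad.has_rank_append[of ?U t] assms
  have "has_rank (?U @\<^sub>r four_block_mat (0\<^sub>m m m1) B4 (0\<^sub>m 0 m1) (0\<^sub>m 0 n)) (t + r)" by simp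
  also have "?U @\<^sub>r four_block_mat (0\<^sub>m m m1) B4 (0\<^sub>m 0 m1) (0\<^sub>m 0 n) = ?M"
    by (rule mat_eq_entrywiseI) (auto simp: append_rows_def simp del: index_mult_mat(1))
  finally have "has_rank ?M (t + r)" .
  moreover have "?T * ?T' = 1\<^sub>m (m1 + n)"
    by (rule mat_eq_entrywiseI) (auto simp: mat_ring simp del: index_mult_mat(1))
  ultimately have "has_rank (1\<^sub>m (m1 + m) * ?M * ?T) (t + r)"
    by (intro has_rank_equiv[of _ _ "1\<^sub>m (m1 + m)" _ _ ?T']) (simp_all add: one_mult_mat)
  also have "1\<^sub>m (m1 + m) * ?M * ?T = block_M A1 B1 A4 B4"
    unfolding block_M_def sol[symmetric]
    by (rule mat_eq_entrywiseI) (simp_all add: mat_ring del: index_mult_mat(1))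
  finally show ?thesis .
qed

text \<open>A congruence moves \<open>X0\<close> out of the corner of the bordered matrix
  [C, B1, 0; B1*, 0, B4*; 0, B4, 0] and produces the block \<open>- (A4 * B4\<^sup>H)\<close>; the
  bordered inertia is known from the padded splitting.\<close>

lemma has_inertia_block_N:
  assumes "has_inertia (four_block_mat (A1 - B1 * X0 * B1\<^sup>H) (B1 * F) ((B1 * F)\<^sup>H) (0\<^sub>m g g)) a b"
  shows "has_inertia (block_N A1 B1 A4 B4) (a + r) (b + r)"
proof -
  let ?C = "A1 - B1 * X0 * B1\<^sup>H"
  let ?K = "four_block_mat ?C B1 (B1\<^sup>H) (0\<^sub>m n n)"
  let ?B = "four_block_mat (0\<^sub>m m m1) B4 (0\<^sub>m 0 m1) (0\<^sub>m 0 n)"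
  let ?F = "four_block_mat (1\<^sub>m m1) (0\<^sub>m m1 g) (0\<^sub>m n m1) F"
  \<comment> \<open>Row and column operations each add one half of
    \<open>B1 * X0 * B1\<^sup>H\<close> and of \<open>- (B4 * X0 * B4\<^sup>H)\<close>, while their
    contributions to the off-diagonal corners cancel.\<close>
  define h :: complex where "h = 1 / 2"
  have [simp]: "cnj h = h" by (simp add: h_def)
  let ?T = "\<lambda>c. four_block_mat (four_block_mat (1\<^sub>m m1) (c \<cdot>\<^sub>m (B1 * X0)) (0\<^sub>m n m1) (1\<^sub>m n)) (0\<^sub>m (m1 + n) m)
      (four_block_mat (0\<^sub>m m m1) (- c \<cdot>\<^sub>m (B4 * X0)) (0\<^sub>m 0 m1) (0\<^sub>m 0 n)) (1\<^sub>m m)"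
  have "?F\<^sup>H * ?K * ?F = four_block_mat ?C (B1 * F) ((B1 * F)\<^sup>H) (0\<^sub>m g g)"
    by (simp add: mat_ring)
  with pad.has_inertia_bordered[of ?K a b] assms
  have N': "has_inertia (four_block_mat ?K (?B\<^sup>H) ?B (0\<^sub>m m m)) (a + r) (b + r)"
    by (simp add: herm mat_ring)
  have "?T (- h) * ?T h = 1\<^sub>m (m1 + n + m)"
    by (rule mat_eq_entrywiseI) (auto simp: mat_ring simp del: index_mult_mat(1))
  then have "has_inertia (?T h * four_block_mat ?K (?B\<^sup>H) ?B (0\<^sub>m m m) * (?T h)\<^sup>H) (a + r) (b + r)"
    by (intro has_inertia_congruence[OF N', of "?T (- h)"]) simp_all
  also have "?T h * four_block_mat ?K (?B\<^sup>H) ?B (0\<^sub>m m m) * (?T h)\<^sup>H = block_N A1 B1 A4 B4"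
    unfolding block_N_def Let_def sol[symmetric]
    by (rule mat_eq_entrywiseI) (simp_all add: mat_ring herm append_rows_def h_def algebra_simps del: index_mult_mat(1), arith?)
  finally show ?thesis .
qed

end

text \<open>The difference \<open>E\<close> of two solutions satisfies \<open>Y * E = 0\<close> and,
  being Hermitian, \<open>E * Y\<^sup>H = 0\<close>; expanding it in the basis of \<open>R\<close>
  and \<open>F\<close> leaves only the \<open>F\<close> block.\<close>

lemma herm_sols_param:
  assumes split: "rank_split B X Y L R F G m n r g" and X0: "X0 \<in> herm_sols n B A"
  shows "S \<in> herm_sols n B A \<longleftrightarrow> (\<exists>W\<in>herm_mats g. S = X0 + F * W * F\<^sup>H)"
proof
  interpret rank_split B X Y L R F G m n r g by (rule split)
  have X0' [simp]: "dim_row X0 = n" "dim_col X0 = n" "X0\<^sup>H = X0" and BX0: "B * X0 = A"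
    using X0 by (auto simp: herm_sols_def herm_mats_def)
  {
    assume "S \<in> herm_sols n B A"
    then have [simp]: "dim_row S = n" "dim_col S = n" "S\<^sup>H = S" and BS: "B * S = A"
      by (auto simp: herm_sols_def herm_mats_def)
    define E where "E = S - X0"
    have [simp]: "dim_row E = n" "dim_col E = n" "E\<^sup>H = E" by (simp_all add: E_def)
    have "B * E = A - A" unfolding E_def by (simp add: mat_ring BS BX0)
    then have BE: "B * E = 0\<^sub>m m n" using BX0 by (auto intro!: eq_matI)
    have "Y * E = L * (X * Y) * E" by (simp add: mat_ring mult_assoc_eq[OF LX] del: XY)
    then have YE: "Y * E = 0\<^sub>m r n" by (simp add: XY mat_ring BE)
    from arg_cong[OF YE, of mat_adjoint] have EY: "E * Y\<^sup>H = 0\<^sub>m n r" by simp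
    have "E = (R * Y + F * G) * E * (R * Y + F * G)\<^sup>H" by (simp add: RY_FG mat_ring del: adj_add)
    also have "\<dots> = F * (G * E * G\<^sup>H) * F\<^sup>H"
      by (simp add: mat_ring YE mult_assoc_eq[OF YE] EY mult_assoc_eq[OF EY])
    finally have EF: "F * (G * E * G\<^sup>H) * F\<^sup>H = E" by (rule sym)
    have "S = X0 + F * (G * E * G\<^sup>H) * F\<^sup>H"
      unfolding EF by (rule mat_eq_entrywiseI) (simp_all add: E_def)
    moreover have "G * E * G\<^sup>H \<in> carrier_mat g g" by (rule carrier_matI) simp_all
    then have "G * E * G\<^sup>H \<in> herm_mats g" by (simp add: herm_mats_def mat_ring)
    ultimately show "\<exists>W\<in>herm_mats g. S = X0 + F * W * F\<^sup>H" by blast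
  }
  assume "\<exists>W\<in>herm_mats g. S = X0 + F * W * F\<^sup>H"
  then obtain W where [simp]: "dim_row W = g" "dim_col W = g" "W\<^sup>H = W" and S: "S = X0 + F * W * F\<^sup>H"
    by (auto simp: herm_mats_def)
  have "X * (Y * F) * (W * F\<^sup>H) = 0\<^sub>m m n" by (simp add: YF mat_ring)
  then have "B * (F * (W * F\<^sup>H)) = 0\<^sub>m m n" by (simp add: XY[symmetric] mat_ring)
  then have "B * S = A" using BX0 by (auto simp: S mat_ring)
  moreover have "S \<in> carrier_mat n n" unfolding S by (rule carrier_matI) simp_all
  ultimately show "S \<in> herm_sols n B A" by (simp add: herm_sols_def herm_mats_def S mat_ring)
qed

text \<open>After cancelling the injective factor \<open>X\<close>, the equation reads
  \<open>Y * S = N\<close> with \<open>N = L * A\<close>, and the symmetry condition says that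
  \<open>N * Y\<^sup>H\<close> is Hermitian.\<close>

lemma herm_sols_nonempty_iff:
  assumes [simp]: "dim_row A = m" "dim_col A = n" "dim_row B = m" "dim_col B = n"
  shows "herm_sols n B A \<noteq> {} \<longleftrightarrow> mrange A \<subseteq> mrange B \<and> A * B\<^sup>H = B * A\<^sup>H"
proof (intro iffI conjI)
  assume "herm_sols n B A \<noteq> {}"
  then obtain S where [simp]: "dim_row S = n" "dim_col S = n" "S\<^sup>H = S" and BS: "B * S = A"
    by (auto simp: herm_sols_def herm_mats_def)
  show "mrange A \<subseteq> mrange B" using mrange_mult_subset[of B S] by (simp add: BS)
  show "A * B\<^sup>H = B * A\<^sup>H" unfolding BS[symmetric] by (simp add: mat_ring)
next
  assume *: "mrange A \<subseteq> mrange B \<and> A * B\<^sup>H = B * A\<^sup>H"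
  then obtain Z where [simp]: "dim_row Z = n" "dim_col Z = n" and BZ: "B * Z = A"
    using mrange_subset_iff[of A B] by auto
  obtain r where "has_rank B r" using has_rank_exists by blast
  then obtain X Y L R F G g where "rank_split B X Y L R F G m n r g"
    using rank_split_exists[of B r] by (metis assms(3,4))
  then interpret rank_split B X Y L R F G m n r g .
  define N where "N = L * A"
  have [simp]: "dim_row N = r" "dim_col N = n" by (simp_all add: N_def)
  have "X * N = X * (L * (X * Y * Z))" unfolding N_def XY BZ ..
  also have "\<dots> = X * Y * Z" by (simp add: mat_ring mult_assoc_eq[OF LX] del: XY)
  finally have XN: "X * N = A" by (simp add: XY BZ)
  have "N * Y\<^sup>H = L * (A * B\<^sup>H) * L\<^sup>H" by (simp add: N_def mat_ring adj_eqs flip: adj_eqs(1))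
  also have "\<dots> = L * (X * Y * A\<^sup>H) * L\<^sup>H" using * by (simp add: XY)
  also have "\<dots> = Y * N\<^sup>H" by (simp add: N_def mat_ring mult_assoc_eq[OF LX] del: XY)
  finally have NY: "N * Y\<^sup>H = Y * N\<^sup>H" .
  \<comment> \<open>\<open>R * N\<close> alone solves \<open>Y * S = N\<close>. Adding its adjoint
    makes \<open>S\<close> symmetric but counts the Hermitian part
    \<open>R * N * Y\<^sup>H * R\<^sup>H\<close> twice, so it is subtracted once.\<close>
  define S where "S = R * N + N\<^sup>H * R\<^sup>H - R * N * Y\<^sup>H * R\<^sup>H"
  have [simp]: "dim_row S = n" "dim_col S = n" by (simp_all add: S_def)
  have "S\<^sup>H = R * N + N\<^sup>H * R\<^sup>H - R * (Y * N\<^sup>H) * R\<^sup>H"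
    unfolding S_def by (rule mat_eq_entrywiseI) (simp_all add: mat_ring del: index_mult_mat(1))
  then have "S\<^sup>H = S" unfolding NY[symmetric] by (simp add: S_def mat_ring)
  moreover have "S \<in> carrier_mat n n" by (rule carrier_matI) simp_all
  moreover have "Y * S = N + Y * N\<^sup>H * R\<^sup>H - N * Y\<^sup>H * R\<^sup>H"
    by (simp add: S_def mat_ring split_simps)
  then have "Y * S = N" unfolding NY by (auto intro!: eq_matI simp del: index_mult_mat(1))
  then have "B * S = A" using XN by (simp add: XY[symmetric] mat_ring)
  ultimately have "S \<in> herm_sols n B A" by (simp add: herm_sols_def herm_mats_def)
  then show "herm_sols n B A \<noteq> {}" by blast
qed

text \<open>\<open>lo\<close> and \<open>hi\<close> are attained bounds, \<open>u\<close> is any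
  further upper bound. Since \<open>u\<close> bounds \<open>f\<close>, it is attained somewhere iff
  \<open>hi = u\<close> and everywhere iff \<open>lo = u\<close>; dually for 0.\<close>

lemma extremal_values:
  fixes f :: "'a \<Rightarrow> nat"
  assumes "\<And>x. x \<in> S \<Longrightarrow> lo \<le> f x" "\<And>x. x \<in> S \<Longrightarrow> f x \<le> hi" "\<And>x. x \<in> S \<Longrightarrow> f x \<le> u"
    and "a \<in> S" "f a = lo" "b \<in> S" "f b = hi"
  shows "has_max_on f S (int hi)" "has_min_on f S (int lo)"
    "(\<exists>x\<in>S. f x = u) \<longleftrightarrow> hi = u" "(\<forall>x\<in>S. f x = u) \<longleftrightarrow> lo = u"
    "(\<exists>x\<in>S. f x = 0) \<longleftrightarrow> lo = 0" "(\<forall>x\<in>S. f x = 0) \<longleftrightarrow> hi = 0"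
proof -
  show "has_max_on f S (int hi)" "has_min_on f S (int lo)"
    using assms unfolding has_max_on_def has_min_on_def by auto
  show "(\<exists>x\<in>S. f x = u) \<longleftrightarrow> hi = u" using assms by (metis order_antisym)
  show "(\<forall>x\<in>S. f x = u) \<longleftrightarrow> lo = u" using assms by (metis order_antisym)
  show "(\<exists>x\<in>S. f x = 0) \<longleftrightarrow> lo = 0" using assms by (metis le_zero_eq)
  show "(\<forall>x\<in>S. f x = 0) \<longleftrightarrow> hi = 0" using assms by (metis le_zero_eq)
qed

lemma append_rows_inject:
  fixes U V U' V' :: "complex mat"
  assumes eq: "U @\<^sub>r V = U' @\<^sub>r V'"
    and d: "dim_row U = dim_row U'" "dim_col U = dim_col V" "dim_col U' = dim_col V'"
  shows "U = U'" "V = V'"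
proof -
  have r: "dim_row V = dim_row V'" and c: "dim_col U = dim_col U'"
    using arg_cong[OF eq, of dim_row] arg_cong[OF eq, of dim_col] d by (simp_all add: append_rows_def)
  have e: "(U @\<^sub>r V) $$ (i, j) = (U' @\<^sub>r V') $$ (i, j)" for i j by (simp only: eq)
  show "U = U'"
  proof (rule mat_eq_entrywiseI)
    fix i j assume "i < dim_row U" "j < dim_col U"
    then show "U $$ (i, j) = U' $$ (i, j)" using e[of i j] d r c by (simp add: append_rows_def)
  qed (use d c in simp_all)
  show "V = V'"
  proof (rule mat_eq_entrywiseI)
    fix i j assume "i < dim_row V" "j < dim_col V"
    then show "V $$ (i, j) = V' $$ (i, j)" using e[of "dim_row U + i" j] d r c by (simp add: append_rows_def)
  qed (use d r c in simp_all)
qed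

section \<open>Rank and inertia formulas with their consequences\<close>

theorem theorem4p1:
  fixes A1 B1 A4 B4 :: "complex mat" and m1 n m :: nat
  defines "S \<equiv> herm_sols n B4 A4"
    and "M \<equiv> block_M A1 B1 A4 B4"
    and "N \<equiv> block_N A1 B1 A4 B4"
  assumes "A1 \<in> herm_mats m1"
    and "B1 \<in> carrier_mat m1 n"
    and "A4 \<in> carrier_mat m n"
    and "B4 \<in> carrier_mat m n"
  shows
    "(S \<noteq> {} \<longleftrightarrow>
        mrange A4 \<subseteq> mrange B4 \<and> A4 * mat_adjoint B4 = B4 * mat_adjoint A4) \<and>
     (S \<noteq> {} \<longrightarrow>
        has_max_on (\<lambda>X. mrank (A1 - B1 * X * mat_adjoint B1)) S (int (mrank M) - int (mrank B4)) \<and>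
        has_min_on (\<lambda>X. mrank (A1 - B1 * X * mat_adjoint B1)) S (2 * int (mrank M) - int (mrank N)) \<and>
        has_max_on (\<lambda>X. pos_inertia (A1 - B1 * X * mat_adjoint B1)) S (int (pos_inertia N) - int (mrank B4)) \<and>
        has_max_on (\<lambda>X. neg_inertia (A1 - B1 * X * mat_adjoint B1)) S (int (neg_inertia N) - int (mrank B4)) \<and>
        has_min_on (\<lambda>X. pos_inertia (A1 - B1 * X * mat_adjoint B1)) S (int (mrank M) - int (neg_inertia N)) \<and>
        has_min_on (\<lambda>X. neg_inertia (A1 - B1 * X * mat_adjoint B1)) S (int (mrank M) - int (pos_inertia N)) \<and>
        \<comment> \<open>(a)\<close>
        ((\<exists>X\<in>S. invertible_mat (A1 - B1 * X * mat_adjoint B1)) \<longleftrightarrow> mrank M = mrank B4 + m1) \<and>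
        \<comment> \<open>(b)\<close>
        ((\<forall>X\<in>S. invertible_mat (A1 - B1 * X * mat_adjoint B1)) \<longleftrightarrow> 2 * mrank M = mrank N + m1) \<and>
        \<comment> \<open>(c)\<close>
        ((\<exists>X\<in>herm_mats n. B1 * X * mat_adjoint B1 = A1 \<and> B4 * X = A4) \<longleftrightarrow>
           mrange (A1 @\<^sub>r (A4 * mat_adjoint B1)) \<subseteq> mrange (B1 @\<^sub>r B4)) \<and>
        \<comment> \<open>(d)\<close>
        ((\<forall>X\<in>S. B1 * X * mat_adjoint B1 = A1) \<longleftrightarrow> mrank M = mrank B4) \<and>
        \<comment> \<open>(e)\<close>
        ((\<exists>X\<in>S. pos_def (A1 - B1 * X * mat_adjoint B1)) \<longleftrightarrow> pos_inertia N = mrank B4 + m1) \<and>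
        ((\<exists>X\<in>S. neg_def (A1 - B1 * X * mat_adjoint B1)) \<longleftrightarrow> neg_inertia N = mrank B4 + m1) \<and>
        \<comment> \<open>(f)\<close>
        ((\<forall>X\<in>S. pos_def (A1 - B1 * X * mat_adjoint B1)) \<longleftrightarrow> mrank M = neg_inertia N + m1) \<and>
        ((\<forall>X\<in>S. neg_def (A1 - B1 * X * mat_adjoint B1)) \<longleftrightarrow> mrank M = pos_inertia N + m1) \<and>
        \<comment> \<open>(g)\<close>
        ((\<exists>X\<in>S. pos_semidef (A1 - B1 * X * mat_adjoint B1)) \<longleftrightarrow> mrank M = pos_inertia N) \<and>
        ((\<exists>X\<in>S. neg_semidef (A1 - B1 * X * mat_adjoint B1)) \<longleftrightarrow> mrank M = neg_inertia N) \<and>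
        \<comment> \<open>(h)\<close>
        ((\<forall>X\<in>S. pos_semidef (A1 - B1 * X * mat_adjoint B1)) \<longleftrightarrow> neg_inertia N = mrank B4) \<and>
        ((\<forall>X\<in>S. neg_semidef (A1 - B1 * X * mat_adjoint B1)) \<longleftrightarrow> pos_inertia N = mrank B4))"
proof -
  let ?C = "\<lambda>X. A1 - B1 * X * mat_adjoint B1"
  have d [simp]: "dim_row A1 = m1" "dim_col A1 = m1" "dim_row B1 = m1" "dim_col B1 = n"
      "dim_row A4 = m" "dim_col A4 = n" "dim_row B4 = m" "dim_col B4 = n"
    and A1H: "A1\<^sup>H = A1"
    using assms(4-7) by (auto simp: herm_mats_def)
  have solvable: "S \<noteq> {} \<longleftrightarrow> mrange A4 \<subseteq> mrange B4 \<and> A4 * B4\<^sup>H = B4 * A4\<^sup>H"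
    unfolding S_def by (rule herm_sols_nonempty_iff) simp_all
  show ?thesis
  proof (rule conjI[OF solvable], rule impI, goal_cases)
    case 1
    then obtain X0 where X0S: "X0 \<in> herm_sols n B4 A4" unfolding S_def by blast
    then have X0 [simp]: "dim_row X0 = n" "dim_col X0 = n" and X0H: "X0\<^sup>H = X0" and sol: "B4 * X0 = A4"
      by (auto simp: herm_sols_def herm_mats_def)
    obtain r where "has_rank B4 r" using has_rank_exists by blast
    then obtain X Y L R F G g where split: "rank_split B4 X Y L R F G m n r g"
      using rank_split_exists[of B4 r] by (metis d(7,8))
    interpret rank_split B4 X Y L R F G m n r g by (rule split)
    let ?J = "B1 * F"
    have C0: "dim_row (?C X0) = m1" "dim_col (?C X0) = m1" "(?C X0)\<^sup>H = ?C X0" "dim_row ?J = m1" "dim_col ?J = g"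
      by (simp_all add: A1H X0H mat_ring)
    obtain p q e k where ek: "e \<le> k" and J: "has_rank ?J k"
      and rM: "has_rank (four_block_mat (?C X0) ?J (0\<^sub>m 0 m1) (0\<^sub>m 0 g)) (p + q + e + k)"
      and iN: "has_inertia (four_block_mat (?C X0) ?J (?J\<^sup>H) (0\<^sub>m g g)) (p + k) (q + k)"
      and range: "\<And>W. W \<in> herm_mats g \<Longrightarrow>
        \<exists>a b. a + b + e \<le> k \<and> has_inertia (?C X0 - ?J * W * ?J\<^sup>H) (p + e + a) (q + e + b)"
      and ex: "\<exists>W\<in>herm_mats g. has_inertia (?C X0 - ?J * W * ?J\<^sup>H) (p + e) (q + e)"
        "\<exists>W\<in>herm_mats g. has_inertia (?C X0 - ?J * W * ?J\<^sup>H) (p + k) (q + e)"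
        "\<exists>W\<in>herm_mats g. has_inertia (?C X0 - ?J * W * ?J\<^sup>H) (p + e) (q + k)"
      by (rule inertia_of_perturbations[OF C0], rule that)
    have M: "mrank M = p + q + e + k + r" and B4: "mrank B4 = r"
      using has_rank_mrank[OF has_rank_block_M[OF split _ _ _ _ _ _ A1H X0H sol rM]] rank(2)
      unfolding M_def by simp_all
    have N: "pos_inertia N = p + k + r" "neg_inertia N = q + k + r" "mrank N = p + q + 2 * k + 2 * r"
      using sylvester_inertia[OF has_inertia_block_N[OF split _ _ _ _ _ _ A1H X0H sol iN]]
      unfolding N_def by simp_all
    have CW: "?C X0 - ?J * W * ?J\<^sup>H = ?C (X0 + F * W * F\<^sup>H)" if "W \<in> herm_mats g" for W
      using that by (intro mat_eq_entrywiseI)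
        (auto simp: herm_mats_def mat_ring simp del: index_mult_mat(1))
    have S: "Z \<in> S \<longleftrightarrow> (\<exists>W\<in>herm_mats g. Z = X0 + F * W * F\<^sup>H)" for Z
      unfolding S_def by (rule herm_sols_param[OF split X0S])
    have inertia: "\<exists>a b. a + b + e \<le> k \<and> has_inertia (?C Z) (p + e + a) (q + e + b)" if "Z \<in> S" for Z
      using that range CW unfolding S by metis
    \<comment> \<open>\<open>Z1\<close> attains all three minima. \<open>Z2\<close> maximizes the
      positive inertia while the negative one stays minimal, \<open>Z3\<close> does the reverse, and
      both maximize the rank.\<close>
    obtain Z1 Z2 Z3 where Z: "Z1 \<in> S" "has_inertia (?C Z1) (p + e) (q + e)"
        "Z2 \<in> S" "has_inertia (?C Z2) (p + k) (q + e)" "Z3 \<in> S" "has_inertia (?C Z3) (p + e) (q + k)"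
      using ex CW unfolding S by metis
    let ?p = "\<lambda>X. pos_inertia (?C X)" and ?q = "\<lambda>X. neg_inertia (?C X)" and ?r = "\<lambda>X. mrank (?C X)"
    note Z' = sylvester_inertia[OF Z(2)] sylvester_inertia[OF Z(4)] sylvester_inertia[OF Z(6)]
    have dC: "dim_row (?C Z) = m1" for Z by simp
    have bounds: "p + e \<le> ?p Z" "?p Z \<le> p + k" "q + e \<le> ?q Z" "?q Z \<le> q + k"
        "p + q + 2 * e \<le> ?r Z" "?r Z \<le> p + q + e + k" "?r Z \<le> m1" "?r Z = ?p Z + ?q Z"
      and chars: "invertible_mat (?C Z) \<longleftrightarrow> ?r Z = m1" "?C Z = 0\<^sub>m m1 m1 \<longleftrightarrow> ?r Z = 0"
        "pos_def (?C Z) \<longleftrightarrow> ?p Z = m1" "neg_def (?C Z) \<longleftrightarrow> ?q Z = m1"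
        "pos_semidef (?C Z) \<longleftrightarrow> ?q Z = 0" "neg_semidef (?C Z) \<longleftrightarrow> ?p Z = 0"
      if "Z \<in> S" for Z
    proof -
      obtain a b where ab: "a + b + e \<le> k" and i: "has_inertia (?C Z) (p + e + a) (q + e + b)"
        using inertia[OF \<open>Z \<in> S\<close>] by blast
      note i' = sylvester_inertia[OF i]
      have c: "?C Z \<in> carrier_mat m1 m1"
        using has_inertia_herm[OF i] by (simp add: herm_mats_def)
      show "p + e \<le> ?p Z" "?p Z \<le> p + k" "q + e \<le> ?q Z" "?q Z \<le> q + k"
        "p + q + 2 * e \<le> ?r Z" "?r Z \<le> p + q + e + k" "?r Z = ?p Z + ?q Z"
        unfolding i' using ab by simp_all
      show "?r Z \<le> m1" unfolding i' using has_inertia_dim_le[OF i] by simp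
      show "invertible_mat (?C Z) \<longleftrightarrow> ?r Z = m1" by (rule invertible_iff_mrank[OF c])
      show "?C Z = 0\<^sub>m m1 m1 \<longleftrightarrow> ?r Z = 0"
        using has_inertia_zero_iff[OF i] unfolding i' by simp
      show "pos_def (?C Z) \<longleftrightarrow> ?p Z = m1" "neg_def (?C Z) \<longleftrightarrow> ?q Z = m1"
        "pos_semidef (?C Z) \<longleftrightarrow> ?q Z = 0" "neg_semidef (?C Z) \<longleftrightarrow> ?p Z = 0"
        unfolding i' using pos_def_iff_inertia[OF i] neg_def_iff_inertia[OF i]
          pos_semidef_iff_inertia[OF i] neg_semidef_iff_inertia[OF i] by simp_all
    qed
    have zero: "?C Z = 0\<^sub>m m1 m1 \<longleftrightarrow> B1 * Z * B1\<^sup>H = A1" if "Z \<in> S" for Z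
    proof
      have dZ: "dim_row Z = n" "dim_col Z = n" using that by (auto simp: S_def herm_sols_def herm_mats_def)
      assume 0: "?C Z = 0\<^sub>m m1 m1"
      show "B1 * Z * B1\<^sup>H = A1"
      proof (rule mat_eq_entrywiseI)
        fix i j assume "i < dim_row (B1 * Z * B1\<^sup>H)" "j < dim_col (B1 * Z * B1\<^sup>H)"
        then show "(B1 * Z * B1\<^sup>H) $$ (i, j) = A1 $$ (i, j)"
          using arg_cong[OF 0, of "\<lambda>M. M $$ (i, j)"] by (simp del: index_mult_mat(1))
      qed simp_all
    qed (auto intro!: eq_matI)
    \<comment> \<open>A common solution is a point of \<open>S\<close> where the rank is 0, and the
      minimal rank on \<open>S\<close> is \<open>p + q + 2 * e\<close>.\<close>
    have common: "(\<exists>X\<in>herm_mats n. B1 * X * B1\<^sup>H = A1 \<and> B4 * X = A4) \<longleftrightarrow> p + q + 2 * e = 0"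
    proof -
      have "(\<exists>X\<in>herm_mats n. B1 * X * B1\<^sup>H = A1 \<and> B4 * X = A4) \<longleftrightarrow> (\<exists>Z\<in>S. B1 * Z * B1\<^sup>H = A1)"
        by (auto simp: S_def herm_sols_def)
      also have "\<dots> \<longleftrightarrow> (\<exists>Z\<in>S. ?r Z = 0)" using zero chars(2) by blast
      also have "\<dots> \<longleftrightarrow> p + q + 2 * e = 0" using Z(1) Z' bounds(5) by fastforce
      finally show ?thesis .
    qed
    have c: "mrange (A1 @\<^sub>r (A4 * B1\<^sup>H)) \<subseteq> mrange (B1 @\<^sub>r B4) \<longleftrightarrow> p + q + 2 * e = 0"
    proof -
      have [simp]: "dim_row (U @\<^sub>r V) = dim_row U + dim_row V" "dim_col (U @\<^sub>r V) = dim_col U" for U V :: "complex mat"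
        by (simp_all add: append_rows_def)
      have prod: "(B1 @\<^sub>r B4) * Z = (B1 * Z) @\<^sub>r (B4 * Z)" if "dim_row Z = n" for Z
        using that by (simp add: append_rows_def mult_col_block)
      show ?thesis
      proof
        assume "mrange (A1 @\<^sub>r (A4 * B1\<^sup>H)) \<subseteq> mrange (B1 @\<^sub>r B4)"
        then obtain Z where [simp]: "dim_row Z = n" "dim_col Z = m1" and "(B1 @\<^sub>r B4) * Z = A1 @\<^sub>r (A4 * B1\<^sup>H)"
          using mrange_subset_iff[of "A1 @\<^sub>r (A4 * B1\<^sup>H)" "B1 @\<^sub>r B4"] by auto
        then have BZ: "(B1 * Z) @\<^sub>r (B4 * Z) = A1 @\<^sub>r (A4 * B1\<^sup>H)" by (simp add: prod)
        \<comment> \<open>\<open>Z\<close> makes M a product with left factor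
          \<open>B1 @\<^sub>r B4\<close>, whose rank is \<open>k + r\<close>; comparison with the
          rank of M forces \<open>p\<close>, \<open>q\<close> and \<open>e\<close> to
          vanish.\<close>
        have "(B1 @\<^sub>r B4) * four_block_mat Z (1\<^sub>m n) (0\<^sub>m 0 m1) (0\<^sub>m 0 n) = M"
          using append_rows_inject[OF BZ] unfolding M_def block_M_def
          by (simp add: append_rows_def mat_ring)
        moreover have "mrank (B1 @\<^sub>r B4) = k + r"
          by (rule has_rank_mrank[OF has_rank_append[OF _ J]]) simp
        moreover have "mrank ((B1 @\<^sub>r B4) * four_block_mat Z (1\<^sub>m n) (0\<^sub>m 0 m1) (0\<^sub>m 0 n)) \<le> mrank (B1 @\<^sub>r B4)"
          by (rule mrank_mult_le) simp
        ultimately have "p + q + e + k + r \<le> k + r" using M by simp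
        then show "p + q + 2 * e = 0" by simp
      next
        assume "p + q + 2 * e = 0"
        then have "\<exists>X\<in>herm_mats n. B1 * X * B1\<^sup>H = A1 \<and> B4 * X = A4" by (simp only: common)
        then obtain Z where Z: "Z \<in> herm_mats n" "B1 * Z * B1\<^sup>H = A1" "B4 * Z = A4" by blast
        then have [simp]: "dim_row Z = n" "dim_col Z = n" by (auto simp: herm_mats_def)
        \<comment> \<open>Conversely, a common solution \<open>Z\<close> yields the coefficient
          matrix \<open>Z * B1\<^sup>H\<close> for the range inclusion.\<close>
        have "(B1 @\<^sub>r B4) * (Z * B1\<^sup>H) = (B1 * Z * B1\<^sup>H) @\<^sub>r (B4 * Z * B1\<^sup>H)"
          by (simp add: prod mult_assoc_mat)
        then have "(B1 @\<^sub>r B4) * (Z * B1\<^sup>H) = A1 @\<^sub>r (A4 * B1\<^sup>H)" by (simp only: Z)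
        then show "mrange (A1 @\<^sub>r (A4 * B1\<^sup>H)) \<subseteq> mrange (B1 @\<^sub>r B4)"
          using mrange_mult_subset[of "B1 @\<^sub>r B4" "Z * B1\<^sup>H"] \<open>dim_row Z = n\<close> by simp
      qed
    qed
    have dm: "p + k \<le> m1" "q + k \<le> m1" "p + q + e + k \<le> m1"
      using bounds(7)[OF Z(3)] bounds(7)[OF Z(5)] unfolding Z' by simp_all
    have le: "?p Z \<le> m1" "?q Z \<le> m1" if "Z \<in> S" for Z
      using bounds(7,8)[OF that] by simp_all
    \<comment> \<open>The upper bound \<open>m1\<close> gives the criteria for nonsingularity and
      definiteness; the value 0 gives those for vanishing and semi-definiteness.\<close>
    note rank_ext = extremal_values[of S "p + q + 2 * e" ?r "p + q + e + k" m1 Z1 Z2]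
    note pos_ext = extremal_values[of S "p + e" ?p "p + k" m1 Z1 Z2]
    note neg_ext = extremal_values[of S "q + e" ?q "q + k" m1 Z1 Z3]
    have *: "(\<exists>Z\<in>S. invertible_mat (?C Z)) \<longleftrightarrow> (\<exists>Z\<in>S. ?r Z = m1)"
      "(\<forall>Z\<in>S. invertible_mat (?C Z)) \<longleftrightarrow> (\<forall>Z\<in>S. ?r Z = m1)"
      "(\<forall>Z\<in>S. B1 * Z * B1\<^sup>H = A1) \<longleftrightarrow> (\<forall>Z\<in>S. ?r Z = 0)"
      "(\<exists>Z\<in>S. pos_def (?C Z)) \<longleftrightarrow> (\<exists>Z\<in>S. ?p Z = m1)"
      "(\<exists>Z\<in>S. neg_def (?C Z)) \<longleftrightarrow> (\<exists>Z\<in>S. ?q Z = m1)"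
      "(\<forall>Z\<in>S. pos_def (?C Z)) \<longleftrightarrow> (\<forall>Z\<in>S. ?p Z = m1)"
      "(\<forall>Z\<in>S. neg_def (?C Z)) \<longleftrightarrow> (\<forall>Z\<in>S. ?q Z = m1)"
      "(\<exists>Z\<in>S. pos_semidef (?C Z)) \<longleftrightarrow> (\<exists>Z\<in>S. ?q Z = 0)"
      "(\<exists>Z\<in>S. neg_semidef (?C Z)) \<longleftrightarrow> (\<exists>Z\<in>S. ?p Z = 0)"
      "(\<forall>Z\<in>S. pos_semidef (?C Z)) \<longleftrightarrow> (\<forall>Z\<in>S. ?q Z = 0)"
      "(\<forall>Z\<in>S. neg_semidef (?C Z)) \<longleftrightarrow> (\<forall>Z\<in>S. ?p Z = 0)"
      using chars zero by blast+
    have r: "has_max_on ?r S (int (p + q + e + k))" "has_min_on ?r S (int (p + q + 2 * e))"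
      "(\<exists>Z\<in>S. ?r Z = m1) \<longleftrightarrow> p + q + e + k = m1" "(\<forall>Z\<in>S. ?r Z = m1) \<longleftrightarrow> p + q + 2 * e = m1"
      "(\<exists>Z\<in>S. ?r Z = 0) \<longleftrightarrow> p + q + 2 * e = 0" "(\<forall>Z\<in>S. ?r Z = 0) \<longleftrightarrow> p + q + e + k = 0"
      by (rule rank_ext; use Z Z' bounds in simp)+
    have p: "has_max_on ?p S (int (p + k))" "has_min_on ?p S (int (p + e))"
      "(\<exists>Z\<in>S. ?p Z = m1) \<longleftrightarrow> p + k = m1" "(\<forall>Z\<in>S. ?p Z = m1) \<longleftrightarrow> p + e = m1"
      "(\<exists>Z\<in>S. ?p Z = 0) \<longleftrightarrow> p + e = 0" "(\<forall>Z\<in>S. ?p Z = 0) \<longleftrightarrow> p + k = 0"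
      by (rule pos_ext; use Z Z' bounds le in simp)+
    have q: "has_max_on ?q S (int (q + k))" "has_min_on ?q S (int (q + e))"
      "(\<exists>Z\<in>S. ?q Z = m1) \<longleftrightarrow> q + k = m1" "(\<forall>Z\<in>S. ?q Z = m1) \<longleftrightarrow> q + e = m1"
      "(\<exists>Z\<in>S. ?q Z = 0) \<longleftrightarrow> q + e = 0" "(\<forall>Z\<in>S. ?q Z = 0) \<longleftrightarrow> q + k = 0"
      by (rule neg_ext; use Z Z' bounds le in simp)+
    \<comment> \<open>The integer differences of the theorem, evaluated in \<open>p\<close>,
      \<open>q\<close>, \<open>e\<close>, \<open>k\<close>, \<open>r\<close>: the contributions of
      \<open>r\<close> cancel, and what remains are the extremal values above.\<close>
    have i: "int (p + q + e + k + r) - int r = int (p + q + e + k)"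
      "2 * int (p + q + e + k + r) - int (p + q + 2 * k + 2 * r) = int (p + q + 2 * e)"
      "int (p + k + r) - int r = int (p + k)" "int (q + k + r) - int r = int (q + k)"
      "int (p + q + e + k + r) - int (q + k + r) = int (p + e)"
      "int (p + q + e + k + r) - int (p + k + r) = int (q + e)" by simp_all
    show ?case
      unfolding M B4 N common c * i r(3-6) p(3-6) q(3-6)
      using r(1,2) p(1,2) q(1,2) by (intro conjI) auto
  qed
qed

end
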